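(* Let $n\ge 2$ be an integer and $q$ a prime power such that $L = PSL(n,q)$ is simple. Let $B$ be a subset of $L$ of size at least $2|L|/q^{\frac{n-1}{3}}$. Then $B^3 = L$.
   Context: For a subset $B$ of a group, $B^3=\{b_1b_2b_3 : b_1,b_2,b_3\in B\}$. $PSL(n,q)$ is the projective special linear group of degree $n$ over the field with $q$ elements. *)

theory Defs
  imports
    Complex_Main
    "HOL-Library.Cardinality"
    "HOL-Algebra.SimpleGroups"
    "Jordan_Normal_Form.Determinant"
begin

definition SL :: "nat \<Rightarrow> 'a::field mat monoid" where
  "SL n = \<lparr>carrier = {A \<in> carrier_mat n n. det A = 1}, monoid.mult = (*), one = 1\<^sub>m n\<rparr>"

definition SL_scalars :: "nat \<Rightarrow> 'a::field mat set" where
  "SL_scalars n = {c \<cdot>\<^sub>m 1\<^sub>m n | c. det (c \<cdot>\<^sub>m 1\<^sub>m n) = 1}"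

(* The elements of PSL n are the cosets of the scalar matrices in SL n; the ground field
   is the type 'a, so PSL(n,q) is this group with q = CARD('a). *)
definition PSL :: "nat \<Rightarrow> 'a::field mat set monoid" where
  "PSL n = SL n Mod SL_scalars n"

lemma group_SL: "group (SL n :: 'a::field mat monoid)"
proof (rule groupI)
  fix A assume "A \<in> carrier (SL n :: 'a mat monoid)"
  then have A: "A \<in> carrier_mat n n" and d: "det A = 1"
    by (auto simp: SL_def)
  obtain B where B: "B \<in> carrier_mat n n" and BA: "B * A = 1\<^sub>m n"
    using det_non_zero_imp_unit[OF A, of "()"] d
    by (auto simp: Units_def ring_mat_def)
  have "det B * det A = 1"
    using det_mult[OF B A] BA by simp
  then have "det B = 1"
    using d by simp
  then show "\<exists>B\<in>carrier (SL n). B \<otimes>\<^bsub>SL n\<^esub> A = \<one>\<^bsub>SL n\<^esub>"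
    using B BA by (auto simp: SL_def)
qed (auto simp: SL_def det_mult)

lemma normal_SL_scalars: "(SL_scalars n :: 'a::field mat set) \<lhd> SL n"
proof -
  interpret group "SL n :: 'a mat monoid"
    by (rule group_SL)
  have comm: "c \<cdot>\<^sub>m 1\<^sub>m n * A = A * (c \<cdot>\<^sub>m 1\<^sub>m n)"
    if "A \<in> carrier_mat n n" for c :: 'a and A
    using mult_smult_distrib[OF that one_carrier_mat, of c]
      mult_smult_assoc_mat[OF one_carrier_mat that, of c] that by simp
  have smult_scalars: "(a \<cdot>\<^sub>m 1\<^sub>m n) * (b \<cdot>\<^sub>m 1\<^sub>m n) = (a * b) \<cdot>\<^sub>m 1\<^sub>m n" for a b :: 'a
    using mult_smult_assoc_mat[of "1\<^sub>m n" n n "b \<cdot>\<^sub>m 1\<^sub>m n" n a]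
    by (auto intro!: eq_matI)
  have sub: "SL_scalars n \<subseteq> carrier (SL n :: 'a mat monoid)"
    by (auto simp: SL_scalars_def SL_def)
  have mult: "A \<otimes>\<^bsub>SL n\<^esub> B \<in> SL_scalars n"
    if AB: "A \<in> SL_scalars n" "B \<in> SL_scalars n" for A B :: "'a mat"
  proof -
    obtain a b where ab: "A = a \<cdot>\<^sub>m 1\<^sub>m n" "B = b \<cdot>\<^sub>m 1\<^sub>m n"
      using AB by (auto simp: SL_scalars_def)
    have "A * B = (a * b) \<cdot>\<^sub>m 1\<^sub>m n"
      unfolding ab using smult_scalars by simp
    moreover have "det (A * B) = 1"
      using AB sub det_mult[of A n B] by (auto simp: SL_def subset_iff)
    ultimately show ?thesis
      by (auto simp: SL_scalars_def SL_def)
  qed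
  have inv: "inv\<^bsub>SL n\<^esub> A \<in> SL_scalars n" if A: "A \<in> SL_scalars n" for A :: "'a mat"
  proof -
    obtain a where a: "A = a \<cdot>\<^sub>m 1\<^sub>m n" "a ^ n = 1"
      using A by (auto simp: SL_scalars_def)
    let ?B = "inverse a \<cdot>\<^sub>m 1\<^sub>m n :: 'a mat"
    have B: "?B \<in> SL_scalars n"
      using a by (auto simp: SL_scalars_def power_inverse)
    have "?B * A = 1\<^sub>m n"
    proof (cases "n = 0")
      case True
      then show ?thesis by (auto intro!: eq_matI simp: a)
    next
      case False
      then have "a \<noteq> 0" using a by (auto simp: power_0_left)
      then show ?thesis
        unfolding a using smult_scalars by (auto intro!: eq_matI)
    qed
    then have "inv\<^bsub>SL n\<^esub> A = ?B"
      using A B sub by (intro inv_equality) (auto simp: SL_def)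
    then show ?thesis using B by simp
  qed
  have "subgroup (SL_scalars n) (SL n :: 'a mat monoid)"
  proof (rule subgroupI[OF sub])
    have "1\<^sub>m n = (1::'a) \<cdot>\<^sub>m 1\<^sub>m n"
      by (intro eq_matI) auto
    then have "1\<^sub>m n \<in> (SL_scalars n :: 'a mat set)"
      by (auto simp: SL_scalars_def intro!: exI[of _ 1])
    then show "SL_scalars n \<noteq> ({} :: 'a mat set)" by blast
  qed (use mult inv in auto)
  then show ?thesis
  proof (rule normalI)
    show "\<forall>A\<in>carrier (SL n). SL_scalars n #>\<^bsub>SL n\<^esub> A = A <#\<^bsub>SL n\<^esub> (SL_scalars n :: 'a mat set)"
    proof
      fix A assume "A \<in> carrier (SL n :: 'a mat monoid)"
      then have "Z * A = A * Z" if "Z \<in> SL_scalars n" for Z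
        using that comm by (auto simp: SL_scalars_def SL_def)
      then show "SL_scalars n #>\<^bsub>SL n\<^esub> A = A <#\<^bsub>SL n\<^esub> SL_scalars n"
        by (auto simp: r_coset_def l_coset_def SL_def)
    qed
  qed
qed

lemma group_PSL: "group (PSL n :: 'a::field mat set monoid)"
  unfolding PSL_def by (rule normal.factorgroup_is_group[OF normal_SL_scalars])

end

theory Submission
  imports Defs "HOL-Analysis.Function_Topology" "HOL-Number_Theory.Cong"
begin

text \<open>Gowers' argument for quasirandom groups, without representation theory. Let \<open>M\<close> be the operator
  \<open>(M f)(x) = \<Sum>b\<in>B. f (b x)\<close> on complex functions on \<open>L\<close>, and let \<open>f\<close> maximise \<open>\<parallel>M f\<parallel>\<close> over the unit
  sphere of the mean-zero functions. As \<open>M\<close> commutes with right translations, every nonzero Fourier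
  component of a translate of \<open>f\<close> with respect to the group \<open>E \<cong> \<bbbF>\<^sub>q^(n-1)\<close> of transvections with a
  common centre is again extremal. Since \<open>L\<close> is simple, some translate of \<open>f\<close> is not \<open>E\<close>-invariant and so
  has a nontrivial component. The normaliser of \<open>E\<close> moves its character to at least \<open>q^(n-1)/4\<close> others,
  which yields as many orthogonal extremal functions, and comparison with the Hilbert--Schmidt norm
  gives \<open>\<parallel>M f\<parallel>\<^sup>2 \<le> 4 |L| |B| \<parallel>f\<parallel>\<^sup>2 / q^(n-1)\<close> for every mean-zero \<open>f\<close>. If \<open>g\<close> is not in \<open>B\<^sup>3\<close>, the
  balanced indicator function of \<open>g B\<^sup>-\<^sup>1\<close> violates this bound.\<close>

section \<open>Bessel's inequality and extremal functions\<close>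

definition sqnorm :: "'s set \<Rightarrow> ('s \<Rightarrow> complex) \<Rightarrow> real" where
  "sqnorm S f = (\<Sum>x\<in>S. (cmod (f x))\<^sup>2)"

lemma sqnorm_nonneg: "sqnorm S f \<ge> 0"
  by (simp add: sqnorm_def sum_nonneg)

lemma sqnorm_eq_0_iff: "finite S \<Longrightarrow> sqnorm S f = 0 \<longleftrightarrow> (\<forall>x\<in>S. f x = 0)"
  by (simp add: sqnorm_def sum_nonneg_eq_0_iff)

lemma sqnorm_scale: "sqnorm S (\<lambda>x. c * f x) = (cmod c)\<^sup>2 * sqnorm S f"
  by (simp add: sqnorm_def norm_mult power_mult_distrib sum_distrib_left)

lemma sqnorm_cong: "(\<And>x. x \<in> S \<Longrightarrow> f x = g x) \<Longrightarrow> sqnorm S f = sqnorm S g"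
  by (simp add: sqnorm_def)

lemma of_real_sqnorm: "complex_of_real (sqnorm S f) = (\<Sum>x\<in>S. f x * cnj (f x))"
  by (simp add: sqnorm_def flip: complex_norm_square)

text \<open>All \<open>u i\<close> share the squared norm \<open>c\<close>, so \<open>p\<close> is
  \<open>c\<close> times the orthogonal projection of \<open>r\<close> onto their span. The claim is
  the nonnegativity of the squared norm of \<open>c * r - p\<close>, which expands to
  \<open>c * (c * sqnorm S r - A)\<close>.\<close>

lemma bessel_inequality:
  assumes "finite S" "finite I" "c > 0"
    and norm: "\<And>i. i \<in> I \<Longrightarrow> sqnorm S (u i) = c"
    and orth: "\<And>i j. i \<in> I \<Longrightarrow> j \<in> I \<Longrightarrow> i \<noteq> j \<Longrightarrow> (\<Sum>x\<in>S. u i x * cnj (u j x)) = 0"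
  shows "(\<Sum>i\<in>I. (cmod (\<Sum>x\<in>S. r x * cnj (u i x)))\<^sup>2) \<le> c * sqnorm S r"
proof -
  define \<alpha> where "\<alpha> i = (\<Sum>x\<in>S. r x * cnj (u i x))" for i
  define p where "p x = (\<Sum>i\<in>I. \<alpha> i * u i x)" for x
  define A where "A = (\<Sum>i\<in>I. (cmod (\<alpha> i))\<^sup>2)"
  have A: "complex_of_real A = (\<Sum>i\<in>I. \<alpha> i * cnj (\<alpha> i))"
    by (simp add: A_def flip: complex_norm_square)
  have rp: "(\<Sum>x\<in>S. r x * cnj (p x)) = A"
  proof -
    have "(\<Sum>x\<in>S. r x * cnj (p x)) = (\<Sum>x\<in>S. \<Sum>i\<in>I. cnj (\<alpha> i) * (r x * cnj (u i x)))"
      by (simp add: p_def sum_distrib_left mult_ac)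
    also have "\<dots> = (\<Sum>i\<in>I. \<Sum>x\<in>S. cnj (\<alpha> i) * (r x * cnj (u i x)))"
      by (rule sum.swap)
    also have "\<dots> = (\<Sum>i\<in>I. cnj (\<alpha> i) * \<alpha> i)"
      by (simp add: \<alpha>_def sum_distrib_left)
    finally show ?thesis by (simp add: A mult_ac)
  qed
  have pp: "sqnorm S p = c * A"
  proof -
    have "complex_of_real (sqnorm S p) =
        (\<Sum>x\<in>S. \<Sum>i\<in>I. \<Sum>j\<in>I. (\<alpha> i * cnj (\<alpha> j)) * (u i x * cnj (u j x)))"
      by (simp add: of_real_sqnorm p_def sum_product mult_ac)
    also have "\<dots> = (\<Sum>i\<in>I. \<Sum>j\<in>I. \<Sum>x\<in>S. (\<alpha> i * cnj (\<alpha> j)) * (u i x * cnj (u j x)))"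
      by (subst sum.swap, rule sum.cong[OF refl], rule sum.swap)
    also have "\<dots> = (\<Sum>i\<in>I. \<Sum>j\<in>I. (\<alpha> i * cnj (\<alpha> j)) * (\<Sum>x\<in>S. u i x * cnj (u j x)))"
      by (simp add: sum_distrib_left)
    also have "\<dots> = (\<Sum>i\<in>I. \<Sum>j\<in>I. if j = i then (\<alpha> i * cnj (\<alpha> i)) * c else 0)"
      using orth norm by (intro sum.cong refl) (auto simp flip: of_real_sqnorm)
    also have "\<dots> = c * A"
      using \<open>finite I\<close> by (simp add: A sum_distrib_left mult_ac)
    finally show ?thesis by (simp only: of_real_eq_iff)
  qed
  have "0 \<le> (\<Sum>x\<in>S. (cmod (c * r x - p x))\<^sup>2)"
    by (simp add: sum_nonneg)
  also have "\<dots> = (\<Sum>x\<in>S. c\<^sup>2 * (cmod (r x))\<^sup>2 + (cmod (p x))\<^sup>2 - 2 * c * Re (r x * cnj (p x)))"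
    by (intro sum.cong refl) (simp add: cmod_power2, simp add: power2_eq_square algebra_simps)
  also have "\<dots> = c\<^sup>2 * sqnorm S r + sqnorm S p - 2 * c * Re (\<Sum>x\<in>S. r x * cnj (p x))"
    by (simp only: sum.distrib sum_subtractf sqnorm_def sum_distrib_left Re_sum)
  also have "\<dots> = c * (c * sqnorm S r - A)"
    by (simp add: rp pp power2_eq_square algebra_simps)
  finally have "A \<le> c * sqnorm S r"
    using \<open>c > 0\<close> by (simp add: zero_le_mult_iff)
  then show ?thesis by (simp add: A_def \<alpha>_def)
qed

text \<open>Compactness of the unit sphere in a finite-dimensional space, for functions defined on a
  whole type. By \<open>hom\<close>, the maximum over unit vectors controls every mean-zero
  function; the two distinct points ensure that the sphere is nonempty.\<close>

lemma exists_max_on_sphere: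
  fixes N :: "('s \<Rightarrow> complex) \<Rightarrow> real"
  assumes "finite S" and cont: "continuous_on UNIV N"
    and hom: "\<And>c f. N (\<lambda>x. c * f x) = (cmod c)\<^sup>2 * N f"
    and cong: "\<And>f g. (\<And>x. x \<in> S \<Longrightarrow> f x = g x) \<Longrightarrow> N f = N g"
    and ab: "a \<in> S" "b \<in> S" "a \<noteq> b"
  obtains f where "sqnorm S f = 1" "sum f S = 0"
    "\<And>g. sum g S = 0 \<Longrightarrow> N g \<le> N f * sqnorm S g"
proof -
  \<comment> \<open>A closed square containing the unit disc; it is visibly the continuous image of
    a compact product.\<close>
  define D where "D = (\<lambda>z. complex_of_real (fst z) + \<i> * complex_of_real (snd z)) ` ({-1..1} \<times> {-1..1})"
  have "compact D"
    unfolding D_def by (intro compact_continuous_image compact_Times compact_Icc continuous_intros)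
  have D: "z \<in> D" if "cmod z \<le> 1" for z
    unfolding D_def using that abs_Re_le_cmod[of z] abs_Im_le_cmod[of z]
    by (intro image_eqI[of _ _ "(Re z, Im z)"]) (auto simp: complex_eq_iff)
  \<comment> \<open>Values outside \<open>S\<close> are forced to be 0: a product of compact sets is
    then compact by Tychonoff, while \<open>cong\<close> guarantees that \<open>N\<close> does not
    notice the change.\<close>
  define P :: "('s \<Rightarrow> complex) set" where "P = PiE UNIV (\<lambda>x. if x \<in> S then D else {0})"
  define K where "K = P \<inter> ({f. sqnorm S f = 1} \<inter> {f. sum f S = 0})"
  have coord: "continuous_on UNIV (\<lambda>f::'s \<Rightarrow> complex. f x)" for x
    by simp
  have "compact P"
    unfolding P_def
    using compactin_PiE[of "\<lambda>_::'s. euclidean :: complex topology" UNIV "\<lambda>x. if x \<in> S then D else {0}"]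
    using \<open>compact D\<close> by (simp add: euclidean_product_topology)
  moreover have "closed {f. sqnorm S f = 1}"
    unfolding sqnorm_def by (intro closed_Collect_eq continuous_intros coord)
  moreover have "closed {f::'s \<Rightarrow> complex. sum f S = 0}"
    by (intro closed_Collect_eq continuous_intros coord)
  ultimately have "compact K"
    unfolding K_def by (intro compact_Int_closed closed_Int)
  define norm1 where "norm1 g = (\<lambda>x. if x \<in> S then complex_of_real (1 / sqrt (sqnorm S g)) * g x else 0)"
    for g :: "'s \<Rightarrow> complex"
  have norm1_K: "norm1 g \<in> K" and N_norm1: "N (norm1 g) * sqnorm S g = N g"
    if g: "sum g S = 0" "sqnorm S g \<noteq> 0" for g
  proof -
    let ?c = "complex_of_real (1 / sqrt (sqnorm S g))"
    have pos: "sqnorm S g > 0"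
      using g(2) sqnorm_nonneg[of S g] by linarith
    have c2: "(cmod ?c)\<^sup>2 * sqnorm S g = 1"
      using pos by (simp add: norm_divide power_divide)
    have eq: "norm1 g x = ?c * g x" if "x \<in> S" for x
      using that by (simp add: norm1_def)
    have 1: "sqnorm S (norm1 g) = 1"
      using sqnorm_cong[of S "norm1 g" "\<lambda>x. ?c * g x"] eq c2 by (simp only: sqnorm_scale)
    have "norm1 g x \<in> D" if "x \<in> S" for x
    proof -
      have "(cmod (norm1 g x))\<^sup>2 \<le> sqnorm S (norm1 g)"
        unfolding sqnorm_def using \<open>finite S\<close> that by (intro member_le_sum) auto
      then show ?thesis
        using 1 by (intro D) (simp add: abs_square_le_1)
    qed
    moreover have "sum (norm1 g) S = 0"
      using g(1) eq by (simp flip: sum_divide_distrib)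
    ultimately show "norm1 g \<in> K"
      using 1 by (auto simp: K_def P_def norm1_def)
    show "N (norm1 g) * sqnorm S g = N g"
      using cong[of "norm1 g" "\<lambda>x. ?c * g x"] eq c2 by (simp only: hom) (simp add: mult_ac)
  qed
  \<comment> \<open>The difference of two point masses is a nonzero mean-zero function, whose
    normalisation lies in \<open>K\<close>.\<close>
  define d where "d x = (if x = a then 1 else if x = b then - 1 else (0::complex))" for x
  have "sum d S = (\<Sum>x\<in>S. (if x = a then 1 else 0) - (if x = b then 1 else 0))"
    using ab by (intro sum.cong) (auto simp: d_def)
  then have "sum d S = 0"
    using ab \<open>finite S\<close> by (simp add: sum_subtractf)
  moreover have "sqnorm S d \<noteq> 0"
    using ab \<open>finite S\<close> by (auto simp: sqnorm_eq_0_iff d_def)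
  ultimately have "K \<noteq> {}"
    using norm1_K by blast
  then obtain f where f: "f \<in> K" and max: "\<And>g. g \<in> K \<Longrightarrow> N g \<le> N f"
    using continuous_attains_sup[OF \<open>compact K\<close> _ continuous_on_subset[OF cont]] by blast
  have "N g \<le> N f * sqnorm S g" if "sum g S = 0" for g
  proof (cases "sqnorm S g = 0")
    case True
    then have "N g = N (\<lambda>x. 0 * g x)"
      using \<open>finite S\<close> by (intro cong) (auto simp: sqnorm_eq_0_iff)
    also have "\<dots> = 0"
      using hom[of 0 g] by (simp only: norm_zero) simp
    finally show ?thesis
      by (simp add: True)
  next
    case False
    then show ?thesis
      using mult_right_mono[OF max[OF norm1_K[OF that False]] sqnorm_nonneg[of S g]]
      by (simp only: N_norm1[OF that False])
  qed
  with f show ?thesis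
    by (intro that[of f]) (auto simp: K_def)
qed

section \<open>Additive characters of finite fields\<close>

text \<open>Choose an additive complement \<open>K\<close> of the prime field. Each \<open>x\<close>
  is congruent modulo \<open>K\<close> to some multiple \<open>j\<close> of 1, unique modulo
  \<open>p\<close>, and the character sends \<open>x\<close> to the \<open>j\<close>-th power of a
  primitive \<open>p\<close>-th root of unity.\<close>

lemma exists_nontrivial_additive_character:
  obtains \<psi> :: "'a::{field,finite} \<Rightarrow> complex"
  where "\<And>x y. \<psi> (x + y) = \<psi> x * \<psi> y" "\<And>x. cmod (\<psi> x) = 1" "\<exists>x. \<psi> x \<noteq> 1"
proof -
  define p where "p = CHAR('a)"
  have p: "prime p"
    unfolding p_def by (rule prime_CHAR_semidom) (simp add: finite_imp_CHAR_pos)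
  \<comment> \<open>Since \<open>p - 1\<close> acts as -1, natural number multiples are already
    closed under subtraction.\<close>
  have p1: "of_nat (p - 1) = (- 1 :: 'a)"
    using prime_gt_0_nat[OF p] by (subst of_nat_diff) (auto simp: p_def)
  have unit: "\<exists>l. of_nat l * of_nat i = (1::'a)" if "\<not> p dvd i" for i
  proof -
    have "coprime i p"
      using p that prime_imp_coprime coprime_commute by blast
    then obtain l where "[i * l = 1] (mod p)"
      using cong_solve_coprime_nat by auto
    then have "of_nat (i * l) = (of_nat 1 :: 'a)"
      unfolding p_def by (simp only: of_nat_eq_iff_cong_CHAR)
    then show ?thesis by (auto simp: mult.commute)
  qed
  \<comment> \<open>A maximal additive subgroup avoiding 1 is a complement of the prime field.\<close>
  define subgroups where "subgroups = {K::'a set. 0 \<in> K \<and> (\<forall>x\<in>K. \<forall>y\<in>K. x - y \<in> K) \<and> 1 \<notin> K}"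
  have "{0} \<in> subgroups" "finite subgroups"
    by (auto simp: subgroups_def)
  then obtain K where K: "K \<in> subgroups" and max: "\<And>K'. K' \<in> subgroups \<Longrightarrow> card K' \<le> card K"
    using Max_in[of "card ` subgroups"] Max_ge[of "card ` subgroups"]
    by (metis (no_types, lifting) empty_iff finite_imageI imageE imageI image_is_empty)
  have K0: "0 \<in> K" and Kdiff: "\<And>x y. x \<in> K \<Longrightarrow> y \<in> K \<Longrightarrow> x - y \<in> K" and K1: "1 \<notin> K"
    using K by (auto simp: subgroups_def)
  have Kneg: "- x \<in> K" if "x \<in> K" for x using Kdiff[OF K0 that] by simp
  have Kadd: "x + y \<in> K" if "x \<in> K" "y \<in> K" for x y
    using Kdiff[OF that(1) Kneg[OF that(2)]] by simp
  have Kmult: "of_nat l * x \<in> K" if "x \<in> K" for l x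
    by (induction l) (auto simp: K0 Kadd that distrib_right)
  have decomp: "\<exists>j. x - of_nat j \<in> K" for x
  proof (cases "x \<in> K")
    case True
    then show ?thesis by (intro exI[of _ 0]) simp
  next
    case False
    \<comment> \<open>The subgroup generated by \<open>K\<close> and \<open>x\<close> is strictly
      larger than \<open>K\<close>, so maximality forces it to contain 1. In
      \<open>1 = k + of_nat i * x\<close> the factor \<open>i\<close> is invertible modulo
      \<open>p\<close>, since otherwise 1 would lie in \<open>K\<close>; solving for
      \<open>x\<close> gives the decomposition.\<close>
    define K' where "K' = {k + of_nat i * x | k i. k \<in> K}"
    have "K \<subseteq> K'"
    proof
      fix k assume "k \<in> K"
      moreover have "k = k + of_nat 0 * x" by simp
      ultimately show "k \<in> K'" unfolding K'_def by blast
    qed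
    moreover have "x \<in> K'"
    proof -
      have "x = 0 + of_nat 1 * x" by simp
      then show ?thesis unfolding K'_def using K0 by blast
    qed
    ultimately have "card K < card K'"
      using False by (intro psubset_card_mono) auto
    then have "K' \<notin> subgroups"
      using max by fastforce
    moreover have "y - z \<in> K'" if "y \<in> K'" "z \<in> K'" for y z
    proof -
      obtain k i k' i' where yz: "y = k + of_nat i * x" "z = k' + of_nat i' * x" "k \<in> K" "k' \<in> K"
        using \<open>y \<in> K'\<close> \<open>z \<in> K'\<close> by (auto simp: K'_def)
      have "of_nat (i + (p - 1) * i') = (of_nat i - of_nat i' :: 'a)"
        using p1 by simp
      then have "y - z = (k - k') + of_nat (i + (p - 1) * i') * x"
        unfolding yz by (simp only:) (simp add: algebra_simps)
      then show ?thesis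
        using Kdiff[OF yz(3,4)] unfolding K'_def by blast
    qed
    ultimately have "1 \<in> K'"
      using \<open>K \<subseteq> K'\<close> K0 by (auto simp: subgroups_def)
    then obtain k i where ki: "1 = k + of_nat i * x" "k \<in> K"
      by (auto simp: K'_def)
    have "\<not> p dvd i"
      using ki K1 by (auto simp: p_def simp flip: of_nat_eq_0_iff_char_dvd)
    then obtain l where l: "of_nat l * of_nat i = (1::'a)"
      using unit by blast
    have "of_nat l = of_nat l * k + (of_nat l * of_nat i) * x"
      using arg_cong[OF ki(1), of "\<lambda>z. of_nat l * z"] by (simp add: algebra_simps)
    then have "x - of_nat l = - (of_nat l * k)"
      unfolding l by (simp add: algebra_simps)
    then show ?thesis
      using Kneg Kmult ki(2) by metis
  qed
  \<comment> \<open>\<open>K\<close> meets the prime field only in 0, which makes the representative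
    \<open>j\<close> unique modulo \<open>p\<close>.\<close>
  have K_int: "p dvd d" if "of_nat d \<in> K" for d
  proof (rule ccontr)
    assume "\<not> p dvd d"
    then obtain l where "of_nat l * of_nat d = (1::'a)" using unit by blast
    then show False using Kmult[OF that, of l] K1 by simp
  qed
  define J where "J x = (SOME j. x - of_nat j \<in> K)" for x
  have J: "x - of_nat (J x) \<in> K" for x
    unfolding J_def using decomp by (rule someI_ex)
  have J_eqI: "\<exists>n::int. int j = int (J x) + n * int p" if "x - of_nat j \<in> K" for x j
  proof -
    have *: "of_nat j - of_nat (J x) \<in> K" "of_nat (J x) - of_nat j \<in> K"
      using Kdiff[OF J[of x] that] Kdiff[OF that J[of x]] by simp_all
    have "int p dvd int j - int (J x)"
    proof (cases "J x \<le> j")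
      case True
      then have "of_nat (j - J x) \<in> K" using * by (simp add: of_nat_diff)
      then have "p dvd j - J x" by (rule K_int)
      with True show ?thesis by (metis of_nat_diff of_nat_dvd_iff)
    next
      case False
      then have "of_nat (J x - j) \<in> K" using * by (simp add: of_nat_diff)
      then have "p dvd J x - j" by (rule K_int)
      with False have "int p dvd int (J x) - int j" by (metis nat_le_linear of_nat_diff of_nat_dvd_iff)
      then show ?thesis by (simp add: dvd_diff_commute)
    qed
    then obtain n where "int j - int (J x) = int p * n" by (elim dvdE)
    then show ?thesis by (intro exI[of _ n]) (simp add: algebra_simps)
  qed
  define \<psi> where "\<psi> x = cis (2 * pi * real (J x) / real p)" for x
  have pos: "real p > 0" using prime_gt_0_nat[OF p] by simp
  \<comment> \<open>The value does not depend on the representative picked by \<open>J\<close>: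
    changing \<open>j\<close> by a multiple of \<open>p\<close> turns the angle by full
    circles.\<close>
  have \<psi>_eqI: "\<psi> x = cis (2 * pi * real j / real p)" if "x - of_nat j \<in> K" for x j
  proof -
    obtain n :: int where n: "int j = int (J x) + n * int p"
      using J_eqI[OF \<open>x - of_nat j \<in> K\<close>] by blast
    have "real j = real (J x) + of_int n * real p"
      using arg_cong[OF n, of real_of_int] by simp
    then have "2 * pi * real j / real p = 2 * pi * real (J x) / real p + 2 * pi * of_int n"
      using pos by (simp add: field_simps)
    then show ?thesis
      by (simp add: \<psi>_def cis_multiple_2pi flip: cis_mult)
  qed
  show ?thesis
  proof (rule that[of \<psi>])
    fix x y
    have "x + y - of_nat (J x + J y) \<in> K"
      using Kadd[OF J[of x] J[of y]] by (simp add: algebra_simps)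
    then have "\<psi> (x + y) = cis (2 * pi * real (J x + J y) / real p)"
      by (rule \<psi>_eqI)
    also have "\<dots> = \<psi> x * \<psi> y"
      by (simp add: \<psi>_def cis_mult add_divide_distrib distrib_left)
    finally show "\<psi> (x + y) = \<psi> x * \<psi> y" .
  next
    show "cmod (\<psi> x) = 1" for x by (simp add: \<psi>_def)
  next
    have "\<psi> 1 = cis (2 * pi * real 1 / real p)"
      by (rule \<psi>_eqI) (simp add: K0)
    moreover have "cis (2 * pi / real p) \<noteq> 1"
    proof
      assume "cis (2 * pi / real p) = 1"
      then have "cos (2 * pi / real p) = 1"
        by (metis cis.sel(1) one_complex.sel(1))
      then obtain n :: int where "2 * pi / real p = of_int n * 2 * pi"
        by (auto simp: cos_one_2pi_int)
      then have "of_int (n * int p) = (1::real)"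
        using pos by (simp add: field_simps)
      then have "n * int p = 1" by (simp only: of_int_eq_1_iff)
      then show False
        using prime_gt_1_nat[OF p] by (metis dvd_triv_right of_nat_1 of_nat_dvd_iff nat_dvd_1_iff_1 less_irrefl)
    qed
    ultimately show "\<exists>x. \<psi> x \<noteq> 1" by (intro exI[of _ 1]) simp
  qed
qed

section \<open>Fourier components with respect to a vector group\<close>

lemma bij_betw_vec_PiE:
  "bij_betw (vec m) (PiE {..<m} Q) {v \<in> carrier_vec m. \<forall>i<m. v $ i \<in> Q i}"
proof (rule bij_betwI')
  show "vec m f = vec m g \<longleftrightarrow> f = g" if "f \<in> PiE {..<m} Q" "g \<in> PiE {..<m} Q" for f g
    using PiE_ext[OF that] by (metis index_vec lessThan_iff)
  show "vec m f \<in> {v \<in> carrier_vec m. \<forall>i<m. v $ i \<in> Q i}" if "f \<in> PiE {..<m} Q" for f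
    using that by auto
  show "\<exists>f\<in>PiE {..<m} Q. v = vec m f" if "v \<in> {v \<in> carrier_vec m. \<forall>i<m. v $ i \<in> Q i}" for v
    using that by (intro bexI[of _ "restrict (\<lambda>i. v $ i) {..<m}"]) auto
qed

lemma card_carrier_vec_entries:
  "card {v \<in> carrier_vec m. \<forall>i<m. v $ i \<in> Q i} = (\<Prod>i<m. card (Q i))"
  using bij_betw_same_card[OF bij_betw_vec_PiE[of m Q]] by (simp add: card_PiE)

lemma finite_carrier_vec: "finite (carrier_vec m :: 'a::finite vec set)"
  using bij_betw_finite[OF bij_betw_vec_PiE[of m "\<lambda>_. UNIV :: 'a set"]]
  by (simp add: finite_PiE)

locale additive_character =
  fixes \<psi> :: "'a::{field,finite} \<Rightarrow> complex"
  assumes character_add: "\<psi> (x + y) = \<psi> x * \<psi> y"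
    and norm_character [simp]: "cmod (\<psi> x) = 1"
    and character_nontrivial: "\<exists>x. \<psi> x \<noteq> 1"
begin

lemma character_nonzero [simp]: "\<psi> x \<noteq> 0"
  using norm_character[of x] by (metis norm_zero zero_neq_one)

lemma character_0 [simp]: "\<psi> 0 = 1"
  using character_add[of 0 0] by simp

lemma character_mult_cnj [simp]: "\<psi> x * cnj (\<psi> x) = 1"
  by (simp flip: complex_norm_square)

lemma cnj_character: "cnj (\<psi> x) = \<psi> (- x)"
proof -
  have "\<psi> x * \<psi> (- x) = \<psi> x * cnj (\<psi> x)"
    by (simp flip: character_add)
  then show ?thesis
    by (metis character_nonzero mult_left_cancel)
qed

lemma exists_character_scalar_prod_neq_1:
  assumes "v \<in> carrier_vec m" "v \<noteq> 0\<^sub>v m"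
  shows "\<exists>a\<in>carrier_vec m. \<psi> (a \<bullet> v) \<noteq> 1"
proof -
  obtain i where i: "i < m" "v $ i \<noteq> 0"
    using assms by (metis carrier_vecD eq_vecI index_zero_vec)
  obtain x where "\<psi> x \<noteq> 1"
    using character_nontrivial by blast
  moreover have "((x / v $ i) \<cdot>\<^sub>v unit_vec m i) \<bullet> v = x"
    using i assms(1) by simp
  ultimately show ?thesis
    by (intro bexI[of _ "(x / v $ i) \<cdot>\<^sub>v unit_vec m i"]) auto
qed

text \<open>For \<open>v\<close> nonzero, shifting the summation variable by a suitable
  \<open>a0\<close> multiplies the sum by a factor other than 1, so the sum vanishes.\<close>

lemma sum_character_scalar_prod:
  assumes v: "v \<in> carrier_vec m"
  shows "(\<Sum>a\<in>carrier_vec m. \<psi> (a \<bullet> v)) =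
    (if v = 0\<^sub>v m then of_nat (card (carrier_vec m :: 'a vec set)) else 0)"
proof (cases "v = 0\<^sub>v m")
  case False
  then obtain a0 where a0: "a0 \<in> carrier_vec m" "\<psi> (a0 \<bullet> v) \<noteq> 1"
    using exists_character_scalar_prod_neq_1 v by blast
  have "bij_betw (\<lambda>a. a0 + a) (carrier_vec m) (carrier_vec m)"
    by (rule bij_betw_byWitness[where f' = "\<lambda>a. - a0 + a"])
      (use a0 in \<open>auto simp flip: assoc_add_vec\<close>)
  then have "(\<Sum>a\<in>carrier_vec m. \<psi> (a \<bullet> v)) = (\<Sum>a\<in>carrier_vec m. \<psi> ((a0 + a) \<bullet> v))"
    by (rule sum.reindex_bij_betw[symmetric])
  also have "\<dots> = \<psi> (a0 \<bullet> v) * (\<Sum>a\<in>carrier_vec m. \<psi> (a \<bullet> v))"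
    using a0(1) v by (simp add: add_scalar_prod_distrib[of _ m] character_add sum_distrib_left)
  finally show ?thesis
    using a0(2) False by simp
qed (simp add: sum.neutral)

end

text \<open>The image of \<open>e\<close> is the elementary abelian group \<open>E\<close> of the
  overview. Its characters are indexed by vectors \<open>a\<close> through \<open>v\<close> mapping
  to the value of the fixed character at the scalar product of \<open>a\<close> and
  \<open>v\<close>.\<close>

locale finite_vec_hom = group G + additive_character \<psi>
  for G :: "('g, 'x) monoid_scheme" (structure) and \<psi> :: "'a::{field,finite} \<Rightarrow> complex" +
  fixes m :: nat and e :: "'a vec \<Rightarrow> 'g"
  assumes finite_carrier: "finite (carrier G)"
    and hom_closed [simp]: "v \<in> carrier_vec m \<Longrightarrow> e v \<in> carrier G"
    and hom_add: "v \<in> carrier_vec m \<Longrightarrow> w \<in> carrier_vec m \<Longrightarrow> e (v + w) = e v \<otimes> e w"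
begin

abbreviation V :: "'a vec set" where "V \<equiv> carrier_vec m"

lemma finite_V [simp]: "finite V"
  by (rule finite_carrier_vec)

lemma V_nonempty [simp]: "V \<noteq> {}"
  using zero_carrier_vec by blast

lemma card_V_pos: "card V > 0"
  by (simp add: card_gt_0_iff)

lemma hom_0 [simp]: "e (0\<^sub>v m) = \<one>"
  using hom_add[of "0\<^sub>v m" "0\<^sub>v m"] l_cancel_one[of "e (0\<^sub>v m)" "e (0\<^sub>v m)"] by simp

lemma bij_betw_translate_V:
  assumes "w \<in> V"
  shows "bij_betw (\<lambda>v. w + v) V V"
  by (rule bij_betw_byWitness[where f' = "\<lambda>a. - w + a"])
    (use assms in \<open>auto simp flip: assoc_add_vec\<close>)

section \<open>Right translations and the Fourier decomposition along cosets of the vector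
  group\<close>

lemma bij_betw_translate:
  assumes "y \<in> carrier G"
  shows "bij_betw (\<lambda>x. x \<otimes> y) (carrier G) (carrier G)"
  by (rule bij_betw_byWitness[where f' = "\<lambda>x. x \<otimes> inv y"]) (use assms in \<open>auto simp: m_assoc\<close>)

lemma sum_translate:
  assumes "y \<in> carrier G"
  shows "(\<Sum>x\<in>carrier G. f (x \<otimes> y)) = sum f (carrier G)"
  by (rule sum.reindex_bij_betw[OF bij_betw_translate[OF assms]])

lemma sqnorm_translate:
  assumes "y \<in> carrier G"
  shows "sqnorm (carrier G) (\<lambda>x. f (x \<otimes> y)) = sqnorm (carrier G) f"
  unfolding sqnorm_def by (rule sum_translate[OF assms])

text \<open>The projection of \<open>f\<close> onto the functions that right translation by
  \<open>e v\<close> multiplies by the character with index \<open>a\<close>.\<close>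

definition component :: "('g \<Rightarrow> complex) \<Rightarrow> 'a vec \<Rightarrow> 'g \<Rightarrow> complex" where
  "component f a x = (\<Sum>v\<in>V. cnj (\<psi> (a \<bullet> v)) * f (x \<otimes> e v)) / of_nat (card V)"

lemma component_translate:
  assumes "x \<in> carrier G" "w \<in> V" "a \<in> V"
  shows "component f a (x \<otimes> e w) = \<psi> (a \<bullet> w) * component f a x"
proof -
  have "(\<Sum>v\<in>V. cnj (\<psi> (a \<bullet> v)) * f (x \<otimes> e w \<otimes> e v)) =
      (\<Sum>v\<in>V. \<psi> (a \<bullet> w) * (cnj (\<psi> (a \<bullet> (w + v))) * f (x \<otimes> e (w + v))))"
  proof (rule sum.cong[OF refl])
    fix v assume "v \<in> V"
    then have "cnj (\<psi> (a \<bullet> (w + v))) = cnj (\<psi> (a \<bullet> w)) * cnj (\<psi> (a \<bullet> v))"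
      using assms by (simp add: scalar_prod_add_distrib[of _ m] character_add)
    then have "\<psi> (a \<bullet> w) * cnj (\<psi> (a \<bullet> (w + v))) = cnj (\<psi> (a \<bullet> v))"
      by (simp flip: mult.assoc)
    then show "cnj (\<psi> (a \<bullet> v)) * f (x \<otimes> e w \<otimes> e v) =
        \<psi> (a \<bullet> w) * (cnj (\<psi> (a \<bullet> (w + v))) * f (x \<otimes> e (w + v)))"
      using assms \<open>v \<in> V\<close> by (simp add: hom_add m_assoc flip: mult.assoc)
  qed
  also have "\<dots> = \<psi> (a \<bullet> w) * (\<Sum>v\<in>V. cnj (\<psi> (a \<bullet> (w + v))) * f (x \<otimes> e (w + v)))"
    by (simp add: sum_distrib_left)
  also have "(\<Sum>v\<in>V. cnj (\<psi> (a \<bullet> (w + v))) * f (x \<otimes> e (w + v))) =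
      (\<Sum>v\<in>V. cnj (\<psi> (a \<bullet> v)) * f (x \<otimes> e v))"
    by (rule sum.reindex_bij_betw[OF bij_betw_translate_V[OF assms(2)]])
  finally show ?thesis
    by (simp add: component_def)
qed

text \<open>Orthogonality with the sum running over the characters; both Fourier inversion and
  Parseval rest on it.\<close>

lemma character_shift:
  assumes "v \<in> V" "w \<in> V"
  shows "(\<Sum>a\<in>V. cnj (\<psi> (a \<bullet> v)) * \<psi> (a \<bullet> w)) = (if w = v then of_nat (card V) else 0)"
proof -
  have "(\<Sum>a\<in>V. cnj (\<psi> (a \<bullet> v)) * \<psi> (a \<bullet> w)) = (\<Sum>a\<in>V. \<psi> (a \<bullet> (w - v)))"
    using assms
    by (intro sum.cong refl)
      (simp add: cnj_character scalar_prod_minus_distrib[of _ m] flip: character_add)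
  moreover have "w = v" if "w - v = 0\<^sub>v m"
  proof (rule eq_vecI)
    show "w $ i = v $ i" if "i < dim_vec v" for i
      using arg_cong[OF \<open>w - v = 0\<^sub>v m\<close>, of "\<lambda>u. u $ i"] that assms by simp
  qed (use assms in simp)
  ultimately show ?thesis
    using assms by (auto simp: sum_character_scalar_prod)
qed

lemma sum_component:
  assumes "x \<in> carrier G"
  shows "(\<Sum>a\<in>V. component f a x) = f x"
proof -
  have "(\<Sum>a\<in>V. component f a x) =
      (\<Sum>v\<in>V. \<Sum>a\<in>V. cnj (\<psi> (a \<bullet> v)) * f (x \<otimes> e v)) / of_nat (card V)"
    unfolding component_def sum_divide_distrib by (rule sum.swap)
  also have "(\<Sum>v\<in>V. \<Sum>a\<in>V. cnj (\<psi> (a \<bullet> v)) * f (x \<otimes> e v)) =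
      (\<Sum>v\<in>V. (\<Sum>a\<in>V. cnj (\<psi> (a \<bullet> v)) * \<psi> (a \<bullet> 0\<^sub>v m)) * f (x \<otimes> e v))"
    by (simp add: sum_distrib_right)
  also have "\<dots> = (\<Sum>v\<in>V. if v = 0\<^sub>v m then of_nat (card V) * f x else 0)"
    using assms by (intro sum.cong refl, subst character_shift) auto
  finally show ?thesis
    using card_V_pos by simp
qed

lemma parseval_V:
  "(\<Sum>a\<in>V. (cmod (\<Sum>v\<in>V. cnj (\<psi> (a \<bullet> v)) * g v))\<^sup>2) = card V * (\<Sum>v\<in>V. (cmod (g v))\<^sup>2)"
proof -
  have "complex_of_real (\<Sum>a\<in>V. (cmod (\<Sum>v\<in>V. cnj (\<psi> (a \<bullet> v)) * g v))\<^sup>2) =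
      (\<Sum>a\<in>V. \<Sum>v\<in>V. \<Sum>w\<in>V. (cnj (\<psi> (a \<bullet> v)) * \<psi> (a \<bullet> w)) * (g v * cnj (g w)))"
    by (simp add: complex_norm_square sum_product mult_ac del: of_real_power)
  also have "\<dots> = (\<Sum>v\<in>V. \<Sum>w\<in>V. \<Sum>a\<in>V. (cnj (\<psi> (a \<bullet> v)) * \<psi> (a \<bullet> w)) * (g v * cnj (g w)))"
    by (subst sum.swap, rule sum.cong[OF refl], rule sum.swap)
  also have "\<dots> = (\<Sum>v\<in>V. \<Sum>w\<in>V. (\<Sum>a\<in>V. cnj (\<psi> (a \<bullet> v)) * \<psi> (a \<bullet> w)) * (g v * cnj (g w)))"
    by (simp add: sum_distrib_right)
  also have "\<dots> = (\<Sum>v\<in>V. \<Sum>w\<in>V. if w = v then of_nat (card V) * (g v * cnj (g v)) else 0)"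
    by (intro sum.cong refl) (auto simp: character_shift)
  also have "\<dots> = complex_of_real (card V * (\<Sum>v\<in>V. (cmod (g v))\<^sup>2))"
    by (simp add: complex_norm_square sum_distrib_left del: of_real_power)
  finally show ?thesis by (simp only: of_real_eq_iff)
qed

text \<open>Parseval is applied at each \<open>x\<close> to the function \<open>v\<close> mapping to
  \<open>f (x \<otimes> e v)\<close>. Summing over \<open>x\<close> counts the norm of
  \<open>f\<close> once for every \<open>v\<close>, by translation invariance, and this cancels the
  division by \<open>card V\<close>.\<close>

lemma sum_sqnorm_component: "(\<Sum>a\<in>V. sqnorm (carrier G) (component f a)) = sqnorm (carrier G) f"
proof -
  have "(\<Sum>a\<in>V. sqnorm (carrier G) (component f a)) =
      (\<Sum>x\<in>carrier G. \<Sum>a\<in>V. (cmod (component f a x))\<^sup>2)"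
    unfolding sqnorm_def by (rule sum.swap)
  also have "\<dots> = (\<Sum>x\<in>carrier G. (\<Sum>v\<in>V. (cmod (f (x \<otimes> e v)))\<^sup>2) / card V)"
  proof (rule sum.cong[OF refl])
    fix x
    have "(\<Sum>a\<in>V. (cmod (component f a x))\<^sup>2) =
        (\<Sum>a\<in>V. (cmod (\<Sum>v\<in>V. cnj (\<psi> (a \<bullet> v)) * f (x \<otimes> e v)))\<^sup>2) / (card V)\<^sup>2"
      by (simp add: component_def norm_divide power_divide flip: sum_divide_distrib)
    also have "\<dots> = (\<Sum>v\<in>V. (cmod (f (x \<otimes> e v)))\<^sup>2) / card V"
      unfolding parseval_V using card_V_pos by (simp add: power2_eq_square)
    finally show "(\<Sum>a\<in>V. (cmod (component f a x))\<^sup>2) = \<dots>" .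
  qed
  also have "\<dots> = (\<Sum>v\<in>V. sqnorm (carrier G) (\<lambda>x. f (x \<otimes> e v))) / card V"
    unfolding sum_divide_distrib[symmetric] sqnorm_def by (subst sum.swap) (rule refl)
  also have "\<dots> = sqnorm (carrier G) f"
    using card_V_pos by (simp add: sqnorm_translate)
  finally show ?thesis .
qed

lemma sum_carrier_component:
  assumes "sum f (carrier G) = 0"
  shows "sum (component f a) (carrier G) = 0"
proof -
  have "sum (component f a) (carrier G) =
      (\<Sum>v\<in>V. cnj (\<psi> (a \<bullet> v)) * (\<Sum>x\<in>carrier G. f (x \<otimes> e v))) / of_nat (card V)"
    unfolding component_def sum_divide_distrib[symmetric] sum_distrib_left
    by (subst sum.swap) (rule refl)
  then show ?thesis
    using assms by (simp add: sum_translate)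
qed

section \<open>The operator of left averaging over a subset and its Hilbert-Schmidt bound\<close>

definition left_average :: "'g set \<Rightarrow> ('g \<Rightarrow> complex) \<Rightarrow> 'g \<Rightarrow> complex" where
  "left_average B f x = (\<Sum>b\<in>B. f (b \<otimes> x))"

lemma left_average_scale: "left_average B (\<lambda>x. c * f x) = (\<lambda>x. c * left_average B f x)"
  by (simp add: fun_eq_iff left_average_def sum_distrib_left)

lemma left_average_translate:
  assumes "B \<subseteq> carrier G" "x \<in> carrier G" "y \<in> carrier G"
  shows "left_average B (\<lambda>z. f (z \<otimes> y)) x = left_average B f (x \<otimes> y)"
  unfolding left_average_def using assms by (intro sum.cong refl) (auto simp: m_assoc)

lemma left_average_component:
  assumes "B \<subseteq> carrier G" "x \<in> carrier G"
  shows "left_average B (component f a) x = component (left_average B f) a x"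
proof -
  have "left_average B (component f a) x =
      (\<Sum>v\<in>V. cnj (\<psi> (a \<bullet> v)) * left_average B (\<lambda>z. f (z \<otimes> e v)) x) / of_nat (card V)"
    unfolding component_def left_average_def sum_divide_distrib[symmetric] sum_distrib_left
    by (subst sum.swap) (rule refl)
  also have "\<dots> = component (left_average B f) a x"
    using assms by (simp add: component_def left_average_translate)
  finally show ?thesis .
qed

lemma sqnorm_left_average_translate:
  assumes "B \<subseteq> carrier G" "y \<in> carrier G"
  shows "sqnorm (carrier G) (left_average B (\<lambda>z. f (z \<otimes> y))) = sqnorm (carrier G) (left_average B f)"
proof -
  have "sqnorm (carrier G) (left_average B (\<lambda>z. f (z \<otimes> y))) =
      sqnorm (carrier G) (\<lambda>x. left_average B f (x \<otimes> y))"
    using left_average_translate assms by (intro sqnorm_cong) auto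
  then show ?thesis
    using assms(2) by (simp add: sqnorm_translate)
qed

text \<open>Right translation by \<open>e v\<close> preserves the inner product but multiplies it by
  the quotient of the two characters at \<open>v\<close>, and some \<open>v\<close> makes this
  quotient differ from 1. Stated for arbitrary functions with the right transformation law, so that
  it applies to translates of a component.\<close>

lemma components_orthogonal:
  assumes "a \<in> V" "b \<in> V" "a \<noteq> b"
    and u: "\<And>x v. x \<in> carrier G \<Longrightarrow> v \<in> V \<Longrightarrow> u (x \<otimes> e v) = \<psi> (a \<bullet> v) * u x"
    and w: "\<And>x v. x \<in> carrier G \<Longrightarrow> v \<in> V \<Longrightarrow> w (x \<otimes> e v) = \<psi> (b \<bullet> v) * w x"
  shows "(\<Sum>x\<in>carrier G. u x * cnj (w x)) = 0"
proof -
  have "a - b \<noteq> 0\<^sub>v m"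
  proof
    assume *: "a - b = 0\<^sub>v m"
    have "a = b"
    proof (rule eq_vecI)
      show "a $ i = b $ i" if "i < dim_vec b" for i
        using arg_cong[OF *, of "\<lambda>u. u $ i"] that assms(1,2) by simp
    qed (use assms in simp)
    with \<open>a \<noteq> b\<close> show False ..
  qed
  then obtain v where v: "v \<in> V" "\<psi> (v \<bullet> (a - b)) \<noteq> 1"
    using exists_character_scalar_prod_neq_1[of "a - b" m] assms(1,2) by auto
  have "\<psi> (v \<bullet> (a - b)) = \<psi> (a \<bullet> v) * cnj (\<psi> (b \<bullet> v))"
    using v(1) assms(1,2)
    by (simp add: scalar_prod_minus_distrib[of _ m] comm_scalar_prod[of v m] cnj_character
        flip: character_add)
  then have neq: "\<psi> (a \<bullet> v) * cnj (\<psi> (b \<bullet> v)) \<noteq> 1"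
    using v(2) by simp
  have "(\<Sum>x\<in>carrier G. u x * cnj (w x)) = (\<Sum>x\<in>carrier G. u (x \<otimes> e v) * cnj (w (x \<otimes> e v)))"
    using sum_translate[OF hom_closed[OF v(1)], of "\<lambda>x. u x * cnj (w x)"] by simp
  also have "\<dots> = (\<psi> (a \<bullet> v) * cnj (\<psi> (b \<bullet> v))) * (\<Sum>x\<in>carrier G. u x * cnj (w x))"
    using v(1) by (simp add: u w sum_distrib_left mult_ac)
  finally show ?thesis
    using neq by simp
qed

text \<open>Row \<open>x\<close> of the matrix of the operator is the indicator function of the
  translate of \<open>B\<close> by \<open>x\<close> on the right.\<close>

lemma left_average_as_inner_product:
  assumes "B \<subseteq> carrier G" "x \<in> carrier G"
  shows "left_average B f x =
    (\<Sum>y\<in>carrier G. (if y \<otimes> inv x \<in> B then 1 else 0) * f y)"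
proof -
  have "(\<Sum>y\<in>carrier G. (if y \<otimes> inv x \<in> B then 1 else 0) * f y) =
      (\<Sum>z\<in>carrier G. (if z \<otimes> x \<otimes> inv x \<in> B then 1 else 0) * f (z \<otimes> x))"
    by (rule sum_translate[OF assms(2), symmetric])
  also have "\<dots> = (\<Sum>z\<in>carrier G. if z \<in> B then f (z \<otimes> x) else 0)"
    using assms(2) by (intro sum.cong refl) (auto simp: m_assoc)
  also have "\<dots> = sum (\<lambda>z. f (z \<otimes> x)) (carrier G \<inter> B)"
    using finite_carrier by (simp add: sum.inter_restrict)
  also have "carrier G \<inter> B = B"
    using assms(1) by blast
  finally show ?thesis
    by (simp add: left_average_def)
qed

lemma sqnorm_shifted_indicator:
  assumes "B \<subseteq> carrier G" "x \<in> carrier G"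
  shows "sqnorm (carrier G) (\<lambda>y. if y \<otimes> inv x \<in> B then 1 else 0) = card B"
proof -
  have "sqnorm (carrier G) (\<lambda>y. if y \<otimes> inv x \<in> B then 1 else 0) =
      sqnorm (carrier G) (\<lambda>y. if y \<in> B then 1 else 0)"
    using sqnorm_translate[of "inv x" "\<lambda>y. if y \<in> B then 1 else 0"] assms(2) by simp
  also have "\<dots> = (\<Sum>y\<in>carrier G. if y \<in> B then 1 else 0)"
    unfolding sqnorm_def by (intro sum.cong) auto
  also have "\<dots> = real (card (carrier G \<inter> B))"
    using finite_carrier by (simp add: sum.inter_restrict[symmetric])
  also have "carrier G \<inter> B = B"
    using assms(1) by blast
  finally show ?thesis .
qed

text \<open>The sum over \<open>x\<close> of Bessel's inequality for the rows of the operator bounds the sum of the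
  squared singular values by its Hilbert--Schmidt norm.\<close>

lemma sum_sqnorm_left_average_le:
  assumes B: "B \<subseteq> carrier G" and "finite I" "c > 0"
    and norm: "\<And>i. i \<in> I \<Longrightarrow> sqnorm (carrier G) (u i) = c"
    and orth: "\<And>i j. i \<in> I \<Longrightarrow> j \<in> I \<Longrightarrow> i \<noteq> j \<Longrightarrow> (\<Sum>x\<in>carrier G. u i x * cnj (u j x)) = 0"
  shows "(\<Sum>i\<in>I. sqnorm (carrier G) (left_average B (u i))) \<le> c * card (carrier G) * card B"
proof -
  have "(\<Sum>i\<in>I. (cmod (left_average B (u i) x))\<^sup>2) \<le> c * card B" if x: "x \<in> carrier G" for x
  proof -
    let ?r = "\<lambda>y. if y \<otimes> inv x \<in> B then 1 else 0 :: complex"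
    have "cmod (left_average B (u i) x) = cmod (\<Sum>y\<in>carrier G. ?r y * cnj (u i y))" for i
    proof -
      have "cnj (left_average B (u i) x) = (\<Sum>y\<in>carrier G. ?r y * cnj (u i y))"
        unfolding left_average_as_inner_product[OF B x] cnj_sum by (intro sum.cong) auto
      then show ?thesis
        by (metis complex_mod_cnj)
    qed
    then show ?thesis
      using bessel_inequality[OF finite_carrier \<open>finite I\<close> \<open>c > 0\<close> norm orth, where r = ?r]
      by (simp add: sqnorm_shifted_indicator[OF B x])
  qed
  then have "(\<Sum>x\<in>carrier G. \<Sum>i\<in>I. (cmod (left_average B (u i) x))\<^sup>2) \<le>
      (\<Sum>x\<in>carrier G. c * card B)"
    by (rule sum_mono)
  also have "(\<Sum>x\<in>carrier G. \<Sum>i\<in>I. (cmod (left_average B (u i) x))\<^sup>2) =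
      (\<Sum>i\<in>I. sqnorm (carrier G) (left_average B (u i)))"
    unfolding sqnorm_def by (rule sum.swap)
  finally show ?thesis
    by (simp add: mult_ac)
qed

text \<open>The operator commutes with taking components, so by Parseval the bounds from
  \<open>max\<close> for the components of \<open>f\<close> add up to the equality for
  \<open>f\<close>. Hence every one of them is an equality.\<close>

lemma sqnorm_left_average_max_component:
  assumes B: "B \<subseteq> carrier G" and f: "sum f (carrier G) = 0" "sqnorm (carrier G) f = 1"
    and max: "\<And>g. sum g (carrier G) = 0 \<Longrightarrow>
      sqnorm (carrier G) (left_average B g) \<le> \<sigma> * sqnorm (carrier G) g"
    and \<sigma>: "sqnorm (carrier G) (left_average B f) = \<sigma>"
    and a: "a \<in> V"
  shows "sqnorm (carrier G) (left_average B (component f a)) = \<sigma> * sqnorm (carrier G) (component f a)"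
proof -
  have "(\<Sum>a\<in>V. sqnorm (carrier G) (left_average B (component f a))) =
      (\<Sum>a\<in>V. sqnorm (carrier G) (component (left_average B f) a))"
    by (intro sum.cong refl sqnorm_cong left_average_component B)
  also have "\<dots> = (\<Sum>a\<in>V. \<sigma> * sqnorm (carrier G) (component f a))"
    by (simp add: sum_sqnorm_component \<sigma> f flip: sum_distrib_left)
  finally have eq: "(\<Sum>a\<in>V. sqnorm (carrier G) (left_average B (component f a))) =
      (\<Sum>a\<in>V. \<sigma> * sqnorm (carrier G) (component f a))" .
  show ?thesis
    using max[OF sum_carrier_component[OF f(1)]]
    by (intro sum_mono_inv[OF eq _ a]) auto
qed

text \<open>The group elements \<open>y\<close> with \<open>f (x y z) = f (x z)\<close> for all \<open>x, z\<close> form a normal subgroup.\<close>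

lemma simple_group_separates_translates:
  assumes "simple_group G" and f: "sum f (carrier G) = 0" "sqnorm (carrier G) f = 1"
    and g: "g \<in> carrier G" "g \<noteq> \<one>"
  shows "\<exists>x\<in>carrier G. \<exists>z\<in>carrier G. f (x \<otimes> g \<otimes> z) \<noteq> f (x \<otimes> z)"
proof (rule ccontr)
  assume neg: "\<not> ?thesis"
  define N where "N = {y \<in> carrier G. \<forall>x\<in>carrier G. \<forall>z\<in>carrier G. f (x \<otimes> y \<otimes> z) = f (x \<otimes> z)}"
  have "subgroup N G"
  proof (rule subgroupI)
    show "N \<noteq> {}" unfolding N_def by (auto intro!: exI[of _ \<one>])
    show "inv y \<in> N" if "y \<in> N" for y
    proof -
      have "f (x \<otimes> inv y \<otimes> z) = f (x \<otimes> z)" if "x \<in> carrier G" "z \<in> carrier G" for x z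
      proof -
        have "f ((x \<otimes> inv y) \<otimes> y \<otimes> z) = f ((x \<otimes> inv y) \<otimes> z)"
          using that \<open>y \<in> N\<close> unfolding N_def by blast
        then show ?thesis
          using that \<open>y \<in> N\<close> by (simp add: N_def m_assoc)
      qed
      then show ?thesis using that by (simp add: N_def)
    qed
    show "y \<otimes> y' \<in> N" if "y \<in> N" "y' \<in> N" for y y'
    proof -
      have "f (x \<otimes> (y \<otimes> y') \<otimes> z) = f (x \<otimes> z)" if "x \<in> carrier G" "z \<in> carrier G" for x z
      proof -
        have "f (x \<otimes> (y \<otimes> y') \<otimes> z) = f (x \<otimes> y \<otimes> (y' \<otimes> z))"
          using that \<open>y \<in> N\<close> \<open>y' \<in> N\<close> by (simp add: N_def m_assoc)
        also have "\<dots> = f (x \<otimes> (y' \<otimes> z))"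
          using that \<open>y \<in> N\<close> \<open>y' \<in> N\<close> by (simp add: N_def)
        also have "\<dots> = f (x \<otimes> z)"
          using that \<open>y' \<in> N\<close> by (simp add: N_def flip: m_assoc)
        finally show ?thesis .
      qed
      then show ?thesis using that by (simp add: N_def)
    qed
  qed (auto simp: N_def)
  moreover have "t \<otimes> y \<otimes> inv t \<in> N" if t: "t \<in> carrier G" and y: "y \<in> N" for t y
  proof -
    have "f (x \<otimes> (t \<otimes> y \<otimes> inv t) \<otimes> z) = f (x \<otimes> z)" if "x \<in> carrier G" "z \<in> carrier G" for x z
    proof -
      have "f (x \<otimes> (t \<otimes> y \<otimes> inv t) \<otimes> z) = f ((x \<otimes> t) \<otimes> y \<otimes> (inv t \<otimes> z))"
        using that t y by (simp add: N_def m_assoc)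
      also have "\<dots> = f ((x \<otimes> t) \<otimes> (inv t \<otimes> z))"
        using that t y by (simp add: N_def)
      also have "(x \<otimes> t) \<otimes> (inv t \<otimes> z) = x \<otimes> (t \<otimes> inv t) \<otimes> z"
        using that t by (simp only: m_assoc inv_closed m_closed)
      also have "\<dots> = x \<otimes> z"
        using that t by simp
      finally show ?thesis .
    qed
    then show ?thesis using t y by (simp add: N_def)
  qed
  ultimately have "N \<lhd> G"
    by (simp add: normal_inv_iff)
  moreover have "g \<in> N"
    using neg g by (auto simp: N_def)
  ultimately have "N = carrier G"
    using simple_group.no_real_normal_subgroup[OF \<open>simple_group G\<close>] g(2) by blast
  \<comment> \<open>Taking \<open>x\<close> and \<open>z\<close> to be the identity in the
    definition of \<open>N\<close> shows that \<open>f\<close> is constant. Having mean zero, it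
    would vanish, against its norm being 1.\<close>
  have const: "f x = f \<one>" if "x \<in> carrier G" for x
  proof -
    have "x \<in> N" using that \<open>N = carrier G\<close> by simp
    then have "f (\<one> \<otimes> x \<otimes> \<one>) = f (\<one> \<otimes> \<one>)" unfolding N_def by blast
    then show ?thesis using that by simp
  qed
  have "sum f (carrier G) = (\<Sum>x\<in>carrier G. f \<one>)"
    by (intro sum.cong refl const)
  also have "\<dots> = of_nat (card (carrier G)) * f \<one>"
    by simp
  finally have "of_nat (card (carrier G)) * f \<one> = 0"
    using f(1) by simp
  moreover have "card (carrier G) \<noteq> 0"
    using finite_carrier by (auto simp: card_eq_0_iff)
  ultimately have "f \<one> = 0"
    by simp
  then have "\<forall>x\<in>carrier G. f x = 0"
    using const by metis
  then have "sqnorm (carrier G) f = 0"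
    using finite_carrier by (simp add: sqnorm_eq_0_iff)
  then show False
    using f(2) by simp
qed

text \<open>The hypothesis \<open>orbit\<close> says that conjugation carries the character
  \<open>a\<close> to at least \<open>k\<close> characters \<open>b\<close>. An extremal component
  for \<open>a\<close>, translated by the conjugating elements, gives one extremal function for each
  \<open>b\<close>. They are orthogonal of equal norm, so the Hilbert-Schmidt bound limits the
  extremal value.\<close>

lemma sqnorm_left_average_le:
  assumes simple: "simple_group G" and B: "B \<subseteq> carrier G"
    and v0: "v0 \<in> V" "e v0 \<noteq> \<one>"
    and orbit: "\<And>a. a \<in> V \<Longrightarrow> a \<noteq> 0\<^sub>v m \<Longrightarrow>
      \<exists>T\<subseteq>V. k \<le> real (card T) \<and>
        (\<forall>b\<in>T. \<exists>h\<in>carrier G. \<forall>v\<in>V. \<exists>w\<in>V. e v \<otimes> h = h \<otimes> e w \<and> a \<bullet> w = b \<bullet> v)"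
    and g: "sum g (carrier G) = 0"
  shows "k * sqnorm (carrier G) (left_average B g) \<le>
    card (carrier G) * card B * sqnorm (carrier G) g"
proof -
  let ?N = "\<lambda>f. sqnorm (carrier G) (left_average B f)"
  obtain f0 where f0: "sqnorm (carrier G) f0 = 1" "sum f0 (carrier G) = 0"
    and max: "\<And>g. sum g (carrier G) = 0 \<Longrightarrow> ?N g \<le> ?N f0 * sqnorm (carrier G) g"
  proof (rule exists_max_on_sphere[of "carrier G" ?N "e v0" \<one>])
    show "continuous_on UNIV ?N"
      unfolding sqnorm_def left_average_def
      by (intro continuous_intros continuous_on_product_coordinates)
    show "?N (\<lambda>x. c * f x) = (cmod c)\<^sup>2 * ?N f" for c f
      by (simp add: left_average_scale sqnorm_scale)
    show "?N f = ?N f'" if "\<And>x. x \<in> carrier G \<Longrightarrow> f x = f' x" for f f'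
      using B by (intro sqnorm_cong) (auto simp: left_average_def that subset_iff intro!: sum.cong)
  qed (use finite_carrier v0 in auto)
  define \<sigma> where "\<sigma> = ?N f0"
  obtain x0 z0 where xz: "x0 \<in> carrier G" "z0 \<in> carrier G" "f0 (x0 \<otimes> e v0 \<otimes> z0) \<noteq> f0 (x0 \<otimes> z0)"
    using simple_group_separates_translates[OF simple f0(2,1)] v0 hom_closed by blast
  \<comment> \<open>Translation by \<open>z0\<close> keeps \<open>f0\<close> extremal and makes it
    visibly not invariant under \<open>e v0\<close>, as seen at \<open>x0\<close>.\<close>
  define f1 where "f1 x = f0 (x \<otimes> z0)" for x
  have f1: "sum f1 (carrier G) = 0" "sqnorm (carrier G) f1 = 1" "?N f1 = \<sigma>"
    unfolding f1_def using xz f0 B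
    by (simp_all add: sum_translate sqnorm_translate sqnorm_left_average_translate \<sigma>_def)
  \<comment> \<open>Otherwise \<open>f1\<close> would equal its trivial component, which is
    invariant under the whole vector group.\<close>
  have "\<exists>a\<in>V. a \<noteq> 0\<^sub>v m \<and> (\<exists>x\<in>carrier G. component f1 a x \<noteq> 0)"
  proof (rule ccontr)
    assume neg: "\<not> ?thesis"
    have *: "f1 x = component f1 (0\<^sub>v m) x" if "x \<in> carrier G" for x
    proof -
      have "f1 x = (\<Sum>a\<in>V. component f1 a x)"
        using that by (simp add: sum_component)
      also have "\<dots> = (\<Sum>a\<in>V. if a = 0\<^sub>v m then component f1 (0\<^sub>v m) x else 0)"
        using neg that by (intro sum.cong) auto
      finally show ?thesis by simp
    qed
    have "f1 (x0 \<otimes> e v0) = f1 x0"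
      using xz(1) v0(1) by (simp add: * component_translate)
    then show False
      using xz by (simp add: f1_def)
  qed
  then obtain a where a: "a \<in> V" "a \<noteq> 0\<^sub>v m" and ne: "\<exists>x\<in>carrier G. component f1 a x \<noteq> 0"
    by blast
  define u where "u = component f1 a"
  define c where "c = sqnorm (carrier G) u"
  have "c > 0"
    using ne sqnorm_nonneg[of "carrier G" u] finite_carrier
    by (auto simp: c_def u_def sqnorm_eq_0_iff less_le)
  have Nu: "?N u = \<sigma> * c"
    unfolding u_def c_def
    by (rule sqnorm_left_average_max_component[OF B f1(1,2) _ f1(3) a(1)]) (simp add: max \<sigma>_def)
  obtain T where T: "T \<subseteq> V" "k \<le> real (card T)"
    and "\<forall>b\<in>T. \<exists>h\<in>carrier G. \<forall>v\<in>V. \<exists>w\<in>V. e v \<otimes> h = h \<otimes> e w \<and> a \<bullet> w = b \<bullet> v"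
    using orbit[OF a] by blast
  then obtain h where h: "\<And>b. b \<in> T \<Longrightarrow> h b \<in> carrier G"
    and hw: "\<And>b v. b \<in> T \<Longrightarrow> v \<in> V \<Longrightarrow> \<exists>w\<in>V. e v \<otimes> h b = h b \<otimes> e w \<and> a \<bullet> w = b \<bullet> v"
    by metis
  \<comment> \<open>Moving \<open>e v\<close> past \<open>h b\<close> replaces it by
    \<open>e w\<close>, so the translate of \<open>u\<close> by \<open>h b\<close> transforms under
    the character \<open>b\<close> in place of \<open>a\<close>.\<close>
  have ub: "u (x \<otimes> e v \<otimes> h b) = \<psi> (b \<bullet> v) * u (x \<otimes> h b)"
    if x: "x \<in> carrier G" and v: "v \<in> V" and b: "b \<in> T" for x v b
  proof -
    obtain w where w: "w \<in> V" "e v \<otimes> h b = h b \<otimes> e w" "a \<bullet> w = b \<bullet> v"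
      using hw[OF b v] by blast
    have "x \<otimes> e v \<otimes> h b = x \<otimes> h b \<otimes> e w"
      using x v w h[OF b] by (simp add: m_assoc)
    then show ?thesis
      using x w a h[OF b] by (simp add: u_def component_translate)
  qed
  have "(\<Sum>b\<in>T. ?N (\<lambda>x. u (x \<otimes> h b))) \<le> c * card (carrier G) * card B"
  proof (rule sum_sqnorm_left_average_le[OF B _ \<open>c > 0\<close>])
    show "finite T" using T finite_V finite_subset by blast
    show "sqnorm (carrier G) (\<lambda>x. u (x \<otimes> h b)) = c" if "b \<in> T" for b
      by (simp add: sqnorm_translate[OF h[OF that]] c_def)
    show "(\<Sum>x\<in>carrier G. u (x \<otimes> h b) * cnj (u (x \<otimes> h b'))) = 0"
      if "b \<in> T" "b' \<in> T" "b \<noteq> b'" for b b'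
      using that T ub by (intro components_orthogonal[of b b']) auto
  qed
  then have "c * (card T * \<sigma>) \<le> c * (card (carrier G) * card B)"
    using h B by (simp add: sqnorm_left_average_translate Nu mult_ac)
  then have "card T * \<sigma> \<le> card (carrier G) * card B"
    using \<open>c > 0\<close> by (simp only: mult_le_cancel_left_pos)
  moreover have "\<sigma> \<ge> 0"
    by (simp add: \<sigma>_def sqnorm_nonneg)
  ultimately have k: "k * \<sigma> \<le> card (carrier G) * card B"
    using mult_right_mono[OF T(2), of \<sigma>] by linarith
  show ?thesis
  proof (cases "k \<ge> 0")
    case True
    have "k * ?N g \<le> (k * \<sigma>) * sqnorm (carrier G) g"
      using mult_left_mono[OF max[OF g] True] by (simp add: \<sigma>_def mult_ac)
    also have "\<dots> \<le> card (carrier G) * card B * sqnorm (carrier G) g"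
      using k by (rule mult_right_mono) (rule sqnorm_nonneg)
    finally show ?thesis .
  next
    case False
    then have "k * ?N g \<le> 0"
      by (intro mult_nonpos_nonneg sqnorm_nonneg) simp
    also have "0 \<le> card (carrier G) * card B * sqnorm (carrier G) g"
      by (simp add: sqnorm_nonneg)
    finally show ?thesis .
  qed
qed

text \<open>For \<open>g\<close> outside the triple product, no product of two elements of
  \<open>B\<close> lies in \<open>C\<close>, the set of all \<open>g \<otimes> inv b\<close>. The
  balanced indicator \<open>f\<close> of \<open>C\<close> therefore has a large constant average on
  \<open>B\<close>, while its norm is at most \<open>card B\<close>; the operator bound then
  contradicts \<open>large\<close>.\<close>

lemma triple_product_eq_carrier:
  assumes simple: "simple_group G" and B: "B \<subseteq> carrier G"
    and v0: "v0 \<in> V" "e v0 \<noteq> \<one>"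
    and orbit: "\<And>a. a \<in> V \<Longrightarrow> a \<noteq> 0\<^sub>v m \<Longrightarrow>
      \<exists>T\<subseteq>V. k \<le> real (card T) \<and>
        (\<forall>b\<in>T. \<exists>h\<in>carrier G. \<forall>v\<in>V. \<exists>w\<in>V. e v \<otimes> h = h \<otimes> e w \<and> a \<bullet> w = b \<bullet> v)"
    and large: "real (card (carrier G)) ^ 3 < k * real (card B) ^ 3"
  shows "B <#> B <#> B = carrier G"
proof
  show "B <#> B <#> B \<subseteq> carrier G"
    using B by (intro set_mult_closed)
  show "carrier G \<subseteq> B <#> B <#> B"
  proof (rule ccontr)
    assume "\<not> carrier G \<subseteq> B <#> B <#> B"
    then obtain g where g: "g \<in> carrier G" "g \<notin> B <#> B <#> B"
      by blast
    define C where "C = (\<lambda>b. g \<otimes> inv b) ` B"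
    define M N where "M = real (card B)" and "N = real (card (carrier G))"
    define f where "f x = (if x \<in> C then 1 else 0) - complex_of_real (M / N)" for x
    have C: "C \<subseteq> carrier G"
      using B g by (auto simp: C_def)
    have "N > 0"
      using finite_carrier by (auto simp: N_def card_gt_0_iff)
    have "M > 0"
    proof (rule ccontr)
      assume "\<not> M > 0"
      then have "M = 0" by (simp add: M_def)
      then show False
        using large \<open>N > 0\<close> by (simp add: M_def N_def)
    qed
    have "inj_on (\<lambda>b. g \<otimes> inv b) B"
      by (intro inj_onI) (metis B g(1) inv_closed inv_inv Units_eq Units_l_cancel subsetD)
    then have "card C = card B"
      by (simp add: C_def card_image)
    moreover have "(\<Sum>x\<in>carrier G. if x \<in> C then 1 else 0) = real (card (carrier G \<inter> C))"
      using finite_carrier by (simp add: sum.inter_restrict[symmetric])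
    moreover have "carrier G \<inter> C = C"
      using C by blast
    ultimately have sum_C: "(\<Sum>x\<in>carrier G. if x \<in> C then 1 else 0) = M"
      by (simp only: M_def)
    have "sum f (carrier G) =
        complex_of_real ((\<Sum>x\<in>carrier G. if x \<in> C then 1 else 0) - (\<Sum>x\<in>carrier G. M / N))"
      unfolding f_def sum_subtractf of_real_diff of_real_sum by (intro arg_cong2[of _ _ _ _ minus] sum.cong) auto
    also have "\<dots> = 0"
      using \<open>N > 0\<close> unfolding sum_C by (simp add: N_def)
    finally have sum_f: "sum f (carrier G) = 0" .
    \<comment> \<open>An indicator equals its own square, so the squared modulus is affine in the
      indicator and only the size of \<open>C\<close> enters.\<close>
    have "sqnorm (carrier G) f =
        (\<Sum>x\<in>carrier G. (1 - 2 * (M / N)) * (if x \<in> C then 1 else 0) + (M / N)\<^sup>2)"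
      unfolding sqnorm_def
    proof (rule sum.cong[OF refl])
      fix x
      have "f x = complex_of_real ((if x \<in> C then 1 else 0) - M / N)"
        by (simp add: f_def)
      then show "(cmod (f x))\<^sup>2 = (1 - 2 * (M / N)) * (if x \<in> C then 1 else 0) + (M / N)\<^sup>2"
        by (simp only: norm_of_real power2_abs) (simp add: power2_eq_square algebra_simps)
    qed
    also have "\<dots> = (1 - 2 * (M / N)) * M + N * (M / N)\<^sup>2"
      unfolding sum.distrib sum_distrib_left[symmetric] sum_C by (simp add: N_def)
    also have "\<dots> = M - M * (M / N)"
      using \<open>N > 0\<close> by (simp add: power2_eq_square left_diff_distrib)
    also have "\<dots> \<le> M"
      using \<open>N > 0\<close> \<open>M > 0\<close> by simp
    finally have sqnorm_f: "sqnorm (carrier G) f \<le> M" .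
    have av: "left_average B f x = - complex_of_real (M\<^sup>2 / N)" if "x \<in> B" for x
    proof -
      have "b \<otimes> x \<notin> C" if "b \<in> B" for b
      proof
        assume "b \<otimes> x \<in> C"
        then obtain b' where b': "b' \<in> B" "b \<otimes> x = g \<otimes> inv b'"
          by (auto simp: C_def)
        then have "g = b \<otimes> x \<otimes> b'"
          using B g \<open>b \<in> B\<close> \<open>x \<in> B\<close> by (auto simp: m_assoc subset_iff)
        then show False
          using g(2) b'(1) \<open>b \<in> B\<close> \<open>x \<in> B\<close> by (auto simp: set_mult_def)
      qed
      then have "left_average B f x = (\<Sum>b\<in>B. - complex_of_real (M / N))"
        unfolding left_average_def by (intro sum.cong) (auto simp: f_def)
      then show ?thesis
        by (simp add: M_def power2_eq_square)
    qed
    \<comment> \<open>Only the points of \<open>B\<close> are kept in the norm; there the average is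
      known from \<open>av\<close>.\<close>
    have "M * (M\<^sup>2 / N)\<^sup>2 = (\<Sum>x\<in>B. (cmod (left_average B f x))\<^sup>2)"
      using av \<open>N > 0\<close> by (simp add: norm_divide norm_power) (simp add: M_def)
    also have "\<dots> \<le> sqnorm (carrier G) (left_average B f)"
      unfolding sqnorm_def using B finite_carrier by (intro sum_mono2) auto
    finally have lower: "M * (M\<^sup>2 / N)\<^sup>2 \<le> sqnorm (carrier G) (left_average B f)" .
    have large': "N ^ 3 < k * M ^ 3"
      using large by (simp only: M_def N_def)
    have "0 < N ^ 3"
      using \<open>N > 0\<close> by simp
    then have "0 < k * M ^ 3"
      using large' by (rule less_trans)
    then have "k > 0"
      using \<open>M > 0\<close> by (simp only: zero_less_mult_pos2 zero_less_power)
    have "k * (M * (M\<^sup>2 / N)\<^sup>2) \<le> k * sqnorm (carrier G) (left_average B f)"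
      using lower \<open>k > 0\<close> by simp
    also have "\<dots> \<le> N * M * sqnorm (carrier G) f"
      using sqnorm_left_average_le[OF simple B v0 orbit sum_f] by (simp add: M_def N_def)
    also have "\<dots> \<le> N * M * M"
      using sqnorm_f \<open>N > 0\<close> \<open>M > 0\<close> by simp
    finally have "N\<^sup>2 * (k * (M * (M\<^sup>2 / N)\<^sup>2)) \<le> N\<^sup>2 * (N * M * M)"
      by (rule mult_left_mono) simp
    moreover have "N\<^sup>2 * (k * (M * (M\<^sup>2 / N)\<^sup>2)) = M\<^sup>2 * (k * M ^ 3)"
    proof -
      have "N\<^sup>2 * (k * (M * (M\<^sup>2 / N)\<^sup>2)) = k * M * (N * (M\<^sup>2 / N))\<^sup>2"
        by (simp only: power_mult_distrib mult_ac)
      also have "N * (M\<^sup>2 / N) = M\<^sup>2"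
        using \<open>N > 0\<close> by simp
      also have "k * M * (M\<^sup>2)\<^sup>2 = M\<^sup>2 * (k * M ^ 3)"
        by (simp only: power2_eq_square power3_eq_cube mult_ac)
      finally show ?thesis .
    qed
    moreover have "N\<^sup>2 * (N * M * M) = M\<^sup>2 * N ^ 3"
      by (simp only: power2_eq_square power3_eq_cube mult_ac)
    ultimately have "M\<^sup>2 * (k * M ^ 3) \<le> M\<^sup>2 * N ^ 3"
      by (simp only:)
    then have "k * M ^ 3 \<le> N ^ 3"
      by (rule mult_left_le_imp_le) (use \<open>M > 0\<close> in simp)
    then show False
      using large' by linarith
  qed
qed

end

section \<open>Transvections\<close>

text \<open>With one root \<open>r s\<close> fixed for every nonzero square \<open>s\<close>, each
  nonzero element is \<open>r s\<close> or \<open>- r s\<close>. In characteristic 2 the two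
  coincide and the bound still holds.\<close>

lemma card_nonzero_squares:
  "CARD('a::{field,finite}) - 1 \<le> 2 * card {t\<^sup>2 | t::'a. t \<noteq> 0}"
proof -
  let ?Q = "{t\<^sup>2 | t::'a. t \<noteq> 0}"
  define r where "r s = (SOME t::'a. t\<^sup>2 = s)" for s
  have r: "(r s)\<^sup>2 = s" if "s \<in> ?Q" for s
    unfolding r_def by (rule someI_ex) (use that in blast)
  have "UNIV - {0} \<subseteq> r ` ?Q \<union> (\<lambda>s. - r s) ` ?Q"
  proof
    fix t :: 'a assume "t \<in> UNIV - {0}"
    then have t: "t\<^sup>2 \<in> ?Q" by blast
    then have "t = r (t\<^sup>2) \<or> t = - r (t\<^sup>2)"
      using r[OF t] by (metis power2_eq_iff)
    with t show "t \<in> r ` ?Q \<union> (\<lambda>s. - r s) ` ?Q" by blast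
  qed
  then have "card (UNIV - {0::'a}) \<le> card (r ` ?Q \<union> (\<lambda>s. - r s) ` ?Q)"
    by (intro card_mono) auto
  also have "\<dots> \<le> card (r ` ?Q) + card ((\<lambda>s. - r s) ` ?Q)"
    by (rule card_Un_le)
  also have "\<dots> \<le> card ?Q + card ?Q"
    by (intro add_mono card_image_le) auto
  finally show ?thesis
    by (simp add: card_Diff_singleton)
qed

text \<open>The identity matrix with \<open>v\<close> written into the first row after the diagonal
  entry, so all these transvections have the first basis vector as centre.\<close>

definition transvection_mat :: "'a::field vec \<Rightarrow> 'a mat" where
  "transvection_mat v =
    four_block_mat (1\<^sub>m 1) (mat_of_row v) (0\<^sub>m (dim_vec v) 1) (1\<^sub>m (dim_vec v))"

text \<open>An element of the normaliser of the transvections; the corner entry corrects the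
  determinant to 1.\<close>

definition scaled_block_mat :: "nat \<Rightarrow> 'a::field mat \<Rightarrow> 'a mat" where
  "scaled_block_mat m A = four_block_mat (inverse (det A) \<cdot>\<^sub>m 1\<^sub>m 1) (0\<^sub>m 1 m) (0\<^sub>m m 1) A"

lemma transvection_mat_carrier:
  "v \<in> carrier_vec m \<Longrightarrow> transvection_mat v \<in> carrier (SL (Suc m))"
  unfolding transvection_mat_def SL_def
  using det_four_block_mat_lower_left_zero[of "1\<^sub>m 1" 1 "mat_of_row v" m "0\<^sub>m m 1" "1\<^sub>m m"]
    four_block_carrier_mat[of "1\<^sub>m 1" 1 1 "1\<^sub>m m" m m "mat_of_row v" "0\<^sub>m m 1"]
  by auto

lemma transvection_mat_add:
  assumes "v \<in> carrier_vec m" "w \<in> carrier_vec m"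
  shows "transvection_mat (v + w) = transvection_mat v * transvection_mat w"
proof -
  have "mat_of_row w + mat_of_row v = mat_of_row (v + w)"
    using assms by (intro eq_matI) (auto simp: mat_of_row_def)
  then show ?thesis
    using assms unfolding transvection_mat_def
    by (subst mult_four_block_mat[of _ 1 1 _ m _ m _ _ 1 _ m]) auto
qed

lemma scaled_block_mat_carrier:
  assumes "A \<in> carrier_mat m m" "det A \<noteq> 0"
  shows "scaled_block_mat m A \<in> carrier (SL (Suc m))"
  unfolding scaled_block_mat_def SL_def
  using assms det_four_block_mat_lower_left_zero[of "inverse (det A) \<cdot>\<^sub>m 1\<^sub>m 1" 1 "0\<^sub>m 1 m" m "0\<^sub>m m 1" A]
    four_block_carrier_mat[of "inverse (det A) \<cdot>\<^sub>m 1\<^sub>m 1" 1 1 A m m "0\<^sub>m 1 m" "0\<^sub>m m 1"]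
  by (auto simp: det_single)

text \<open>Both block products agree outside the upper right corner. There one has the row
  \<open>v\<close> times \<open>A\<close>, the other the new row divided by \<open>det A\<close>,
  which dictates the vector on the right.\<close>

lemma transvection_mat_scaled_block_mat:
  assumes A: "A \<in> carrier_mat m m" "det A \<noteq> 0" and v: "v \<in> carrier_vec m"
  shows "transvection_mat v * scaled_block_mat m A =
    scaled_block_mat m A * transvection_mat (det A \<cdot>\<^sub>v (transpose_mat A *\<^sub>v v))"
proof -
  have "mat_of_row v * A = inverse (det A) \<cdot>\<^sub>m mat_of_row (det A \<cdot>\<^sub>v (transpose_mat A *\<^sub>v v))"
  proof (rule eq_matI)
    fix r j assume rj: "r < dim_row (inverse (det A) \<cdot>\<^sub>m mat_of_row (det A \<cdot>\<^sub>v (transpose_mat A *\<^sub>v v)))"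
      "j < dim_col (inverse (det A) \<cdot>\<^sub>m mat_of_row (det A \<cdot>\<^sub>v (transpose_mat A *\<^sub>v v)))"
    then have "(mat_of_row v * A) $$ (r, j) = v \<bullet> col A j"
      using assms by simp
    also have "\<dots> = col A j \<bullet> v"
      using rj assms by (intro comm_scalar_prod[of _ m]) auto
    finally show "(mat_of_row v * A) $$ (r, j) =
        (inverse (det A) \<cdot>\<^sub>m mat_of_row (det A \<cdot>\<^sub>v (transpose_mat A *\<^sub>v v))) $$ (r, j)"
      using rj assms by simp
  qed (use assms in auto)
  moreover define R where "R = mat_of_row (det A \<cdot>\<^sub>v (transpose_mat A *\<^sub>v v))"
  moreover have R: "R \<in> carrier_mat 1 m"
    using assms by (auto simp: R_def mat_of_row_def)
  have "(inverse (det A) \<cdot>\<^sub>m 1\<^sub>m 1) * R + 0\<^sub>m 1 m = inverse (det A) \<cdot>\<^sub>m R"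
      "0\<^sub>m 1 m + inverse (det A) \<cdot>\<^sub>m R = inverse (det A) \<cdot>\<^sub>m R" "0\<^sub>m m 1 * R + A = A"
    using R A mult_smult_assoc_mat[OF one_carrier_mat R] by auto
  ultimately show ?thesis
    using assms R unfolding transvection_mat_def scaled_block_mat_def R_def[symmetric]
    by (subst (1 2) mult_four_block_mat[of _ 1 1 _ m _ m _ _ 1 _ m]) auto
qed

text \<open>Transposing \<open>A\<close> across the scalar product reduces the claim to finding
  \<open>A\<close> with \<open>det A\<close> times \<open>A *\<^sub>v a\<close> equal to
  \<open>b\<close>. The square arises in coordinate \<open>i\<close>, where the factor
  \<open>t\<close> enters once from \<open>det A\<close> and once from the entry of
  \<open>A\<close>.\<close>

lemma transvection_orbit:
  fixes a b :: "'a::field vec"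
  assumes a: "a \<in> carrier_vec m" and i: "i < m" "a $ i \<noteq> 0"
    and b: "b \<in> carrier_vec m" "b $ i = a $ i * t\<^sup>2" and t: "t \<noteq> 0"
  shows "\<exists>h\<in>carrier (SL (Suc m)). \<forall>v\<in>carrier_vec m. \<exists>w\<in>carrier_vec m.
    transvection_mat v * h = h * transvection_mat w \<and> a \<bullet> w = b \<bullet> v"
proof -
  \<comment> \<open>\<open>w\<close> solves \<open>t \<cdot> (A a) = b\<close> for the identity matrix \<open>A\<close> with column \<open>i\<close> replaced by \<open>w\<close>.\<close>
  define w where "w = vec m (\<lambda>j. if j = i then t else (b $ j / t - a $ j) / a $ i)"
  define A where "A = replace_col (1\<^sub>m m) w i"
  have A: "A \<in> carrier_mat m m"
    by (simp add: A_def replace_col_def)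
  \<comment> \<open>Cramer's lemma for the identity matrix: the determinant is the entry
    \<open>w $ i\<close>.\<close>
  have det: "det A = t"
    using cramer_lemma_mat[of "1\<^sub>m m" m w i] i by (simp add: A_def w_def)
  have "det A \<cdot>\<^sub>v (A *\<^sub>v a) = b"
  proof (rule eq_vecI)
    fix j assume j: "j < dim_vec b"
    have "(A *\<^sub>v a) $ j = (\<Sum>l\<in>{0..<m}. A $$ (j, l) * a $ l)"
      using A j a b by (auto simp: scalar_prod_def intro!: sum.cong)
    \<comment> \<open>Row \<open>j\<close> has the new entry in column \<open>i\<close> and the old
      diagonal 1 in column \<open>j\<close>; for \<open>j = i\<close> the latter has been
      overwritten.\<close>
    also have "\<dots> = (\<Sum>l\<in>{0..<m}. (if l = i then w $ j * a $ i else 0) +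
        (if l = j then (if j = i then 0 else a $ j) else 0))"
    proof (rule sum.cong[OF refl])
      fix l assume "l \<in> {0..<m}"
      then have "A $$ (j, l) = (if l = i then w $ j else if j = l then 1 else 0)"
        using j b(1) by (simp add: A_def replace_col_def)
      then show "A $$ (j, l) * a $ l = (if l = i then w $ j * a $ i else 0) +
          (if l = j then (if j = i then 0 else a $ j) else 0)"
        by simp
    qed
    also have "\<dots> = w $ j * a $ i + (if j = i then 0 else a $ j)"
      using i j b by (simp add: sum.distrib)
    finally show "(det A \<cdot>\<^sub>v (A *\<^sub>v a)) $ j = b $ j"
      using i j A b t by (auto simp: det w_def power2_eq_square)
  qed (use A b in simp)
  then have b_eq: "b = det A \<cdot>\<^sub>v (A *\<^sub>v a)" ..
  show ?thesis
  proof (intro bexI[of _ "scaled_block_mat m A"] ballI)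
    show "scaled_block_mat m A \<in> carrier (SL (Suc m))"
      using A det t by (intro scaled_block_mat_carrier) auto
    fix v :: "'a vec" assume v: "v \<in> carrier_vec m"
    let ?w = "det A \<cdot>\<^sub>v (transpose_mat A *\<^sub>v v)"
    have Av: "transpose_mat A *\<^sub>v v \<in> carrier_vec m" and Aa: "A *\<^sub>v a \<in> carrier_vec m"
      using A a v by auto
    have "a \<bullet> ?w = det A * (a \<bullet> (transpose_mat A *\<^sub>v v))"
      using a Av by simp
    also have "a \<bullet> (transpose_mat A *\<^sub>v v) = (transpose_mat A *\<^sub>v v) \<bullet> a"
      by (rule comm_scalar_prod[OF a Av])
    also have "\<dots> = v \<bullet> (A *\<^sub>v a)"
      by (rule transpose_vec_mult_scalar[OF A a v])
    also have "\<dots> = (A *\<^sub>v a) \<bullet> v"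
      by (rule comm_scalar_prod[OF v Aa])
    also have "det A * ((A *\<^sub>v a) \<bullet> v) = b \<bullet> v"
      using Aa v by (simp add: b_eq)
    finally have "a \<bullet> ?w = b \<bullet> v" .
    moreover have "transvection_mat v * scaled_block_mat m A = scaled_block_mat m A * transvection_mat ?w"
      using A det t v by (intro transvection_mat_scaled_block_mat) auto
    ultimately show "\<exists>w\<in>carrier_vec m.
        transvection_mat v * scaled_block_mat m A = scaled_block_mat m A * transvection_mat w \<and>
        a \<bullet> w = b \<bullet> v"
      using Av by (intro bexI[of _ ?w]) auto
  qed
qed

text \<open>Coordinate \<open>i\<close> has at least \<open>(q - 1) / 2\<close> choices, which is at
  least \<open>q / 4\<close> because \<open>q \<ge> 2\<close>; all other coordinates are
  free.\<close>

lemma card_transvection_orbit: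
  fixes a :: "'a::{field,finite} vec"
  assumes i: "i < m" "a $ i \<noteq> 0"
  shows "real CARD('a) ^ m / 4 \<le> card {b \<in> carrier_vec m. \<exists>t. t \<noteq> 0 \<and> b $ i = a $ i * t\<^sup>2}"
proof -
  let ?Q = "{t\<^sup>2 | t::'a. t \<noteq> 0}"
  let ?q = "CARD('a)"
  have "{b \<in> carrier_vec m. \<exists>t. t \<noteq> 0 \<and> b $ i = a $ i * t\<^sup>2} =
      {b \<in> carrier_vec m. \<forall>j<m. b $ j \<in> (if j = i then (*) (a $ i) ` ?Q else UNIV)}"
    using i by auto
  then have "card {b \<in> carrier_vec m. \<exists>t. t \<noteq> 0 \<and> b $ i = a $ i * t\<^sup>2} =
      (\<Prod>j<m. card (if j = i then (*) (a $ i) ` ?Q else UNIV))"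
    by (simp only: card_carrier_vec_entries)
  also have "\<dots> = card ((*) (a $ i) ` ?Q) * (\<Prod>j\<in>{..<m} - {i}. ?q)"
    using i by (subst prod.remove[of _ i]) auto
  also have "card ((*) (a $ i) ` ?Q) = card ?Q"
    using i by (intro card_image) (auto simp: inj_on_def)
  also have "(\<Prod>j\<in>{..<m} - {i}. ?q) = ?q ^ (m - 1)"
    using i by simp
  finally have card: "card {b \<in> carrier_vec m. \<exists>t. t \<noteq> 0 \<and> b $ i = a $ i * t\<^sup>2} =
      card ?Q * ?q ^ (m - 1)" .
  have "?q \<ge> 2"
    using card_mono[of "UNIV :: 'a set" "{0, 1}"] by simp
  then have "?q \<le> 4 * card ?Q"
    using card_nonzero_squares[where ?'a = 'a] by linarith
  then have "?q * ?q ^ (m - 1) \<le> 4 * card ?Q * ?q ^ (m - 1)"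
    by (rule mult_right_mono) simp
  also have "?q * ?q ^ (m - 1) = ?q ^ m"
    using i by (cases m) auto
  finally have "real (?q ^ m) \<le> real (4 * card ?Q * ?q ^ (m - 1))"
    by (simp only: of_nat_le_iff)
  then show ?thesis
    unfolding card by simp
qed

section \<open>Finiteness of PSL and the image of the transvections in it\<close>

lemma finite_carrier_mat: "finite (carrier_mat n k :: 'a::finite mat set)"
proof (rule finite_subset)
  show "carrier_mat n k \<subseteq> mat n k ` PiE ({..<n} \<times> {..<k}) (\<lambda>_. UNIV :: 'a set)"
  proof
    fix A :: "'a mat" assume "A \<in> carrier_mat n k"
    then show "A \<in> mat n k ` PiE ({..<n} \<times> {..<k}) (\<lambda>_. UNIV)"
      by (intro image_eqI[of A "mat n k" "restrict (\<lambda>ij. A $$ ij) ({..<n} \<times> {..<k})"] eq_matI) auto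
  qed
qed (intro finite_imageI finite_PiE, auto)

lemma finite_carrier_PSL: "finite (carrier (PSL n :: 'a::{field,finite} mat set monoid))"
proof -
  have "finite (carrier (SL n :: 'a mat monoid))"
    by (rule finite_subset[OF _ finite_carrier_mat[of n n]]) (auto simp: SL_def)
  then show ?thesis
    by (simp add: PSL_def FactGroup_def RCOSETS_def)
qed

definition to_PSL :: "nat \<Rightarrow> 'a::field mat \<Rightarrow> 'a mat set" where
  "to_PSL n A = SL_scalars n #>\<^bsub>SL n\<^esub> A"

lemma to_PSL_closed: "A \<in> carrier (SL n) \<Longrightarrow> to_PSL n A \<in> carrier (PSL n)"
  using normal.r_coset_hom_Mod[OF normal_SL_scalars, of n]
  by (auto simp: to_PSL_def PSL_def hom_def Pi_def)

lemma to_PSL_mult: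
  "A \<in> carrier (SL n) \<Longrightarrow> B \<in> carrier (SL n) \<Longrightarrow>
    to_PSL n (A * B) = to_PSL n A \<otimes>\<^bsub>PSL n\<^esub> to_PSL n B"
  using normal.r_coset_hom_Mod[OF normal_SL_scalars, of n]
  by (auto simp: to_PSL_def PSL_def hom_def Pi_def SL_def)

text \<open>A scalar matrix has no nonzero entry off the diagonal, whereas this transvection has a 1
  in row 0 and column \<open>Suc i\<close>.\<close>

lemma to_PSL_transvection_neq_one:
  assumes "i < m"
  shows "to_PSL (Suc m) (transvection_mat (unit_vec m i)) \<noteq> \<one>\<^bsub>PSL (Suc m)\<^esub>"
proof
  let ?A = "transvection_mat (unit_vec m i) :: 'a mat"
  assume "to_PSL (Suc m) ?A = \<one>\<^bsub>PSL (Suc m)\<^esub>"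
  then have "SL_scalars (Suc m) #>\<^bsub>SL (Suc m)\<^esub> ?A = SL_scalars (Suc m)"
    by (simp add: to_PSL_def PSL_def FactGroup_def)
  then have "?A \<in> SL_scalars (Suc m)"
    using group.coset_join1[OF group_SL] transvection_mat_carrier[of "unit_vec m i" m]
      normal_imp_subgroup[OF normal_SL_scalars, of "Suc m"] by auto
  then obtain c where "?A = c \<cdot>\<^sub>m 1\<^sub>m (Suc m)"
    by (auto simp: SL_scalars_def)
  then have "?A $$ (0, Suc i) = 0"
    using assms by simp
  then show False
    using assms by (simp add: transvection_mat_def)
qed

theorem proposition2:
  fixes n q :: nat and L :: "'a::{field,finite} mat set monoid" and B :: "'a mat set set"
  assumes "n \<ge> 2"
    and "q = CARD('a)"
    and "L = PSL n"
    and "simple_group L"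
    and "B \<subseteq> carrier L"
    and "real (card B) \<ge> 2 * real (Coset.order L) / real q powr ((real n - 1) / 3)"
  shows "B <#>\<^bsub>L\<^esub> B <#>\<^bsub>L\<^esub> B = carrier L"
proof -
  \<comment> \<open>\<open>m = n - 1\<close> is the dimension of the group of transvections, and the
    exponent of \<open>q\<close> that appears on cubing the size bound.\<close>
  obtain m where n: "n = Suc m" and m: "m \<ge> 1"
    using \<open>n \<ge> 2\<close> by (cases n) auto
  obtain \<psi> :: "'a \<Rightarrow> complex"
    where \<psi>: "\<And>x y. \<psi> (x + y) = \<psi> x * \<psi> y" "\<And>x. cmod (\<psi> x) = 1" "\<exists>x. \<psi> x \<noteq> 1"
    using exists_nontrivial_additive_character by metis
  define e where "e v = to_PSL n (transvection_mat v)" for v :: "'a vec"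
  have e_mult: "e v \<otimes>\<^bsub>L\<^esub> to_PSL n h = to_PSL n (transvection_mat v * h)"
    and mult_e: "to_PSL n h \<otimes>\<^bsub>L\<^esub> e v = to_PSL n (h * transvection_mat v)"
    if "v \<in> carrier_vec m" "h \<in> carrier (SL n)" for v h
    using that transvection_mat_carrier[of v m] by (simp_all add: e_def n \<open>L = PSL n\<close> to_PSL_mult)
  interpret finite_vec_hom L \<psi> m e
  proof (intro finite_vec_hom.intro additive_character.intro finite_vec_hom_axioms.intro)
    show "group L"
      using group_PSL by (simp add: \<open>L = PSL n\<close>)
    show "finite (carrier L)"
      using finite_carrier_PSL by (simp add: \<open>L = PSL n\<close>)
    show "e v \<in> carrier L" if "v \<in> carrier_vec m" for v
      using that transvection_mat_carrier[of v m] by (simp add: e_def n \<open>L = PSL n\<close> to_PSL_closed)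
    show "e (v + w) = e v \<otimes>\<^bsub>L\<^esub> e w" if "v \<in> carrier_vec m" "w \<in> carrier_vec m" for v w
      using that e_mult[of v "transvection_mat w"] transvection_mat_carrier[of w m]
      by (simp add: e_def n transvection_mat_add[of _ m])
  qed (use \<psi> in auto)
  have orbit: "\<exists>T\<subseteq>carrier_vec m. real q ^ m / 4 \<le> real (card T) \<and>
      (\<forall>b\<in>T. \<exists>h\<in>carrier L. \<forall>v\<in>carrier_vec m. \<exists>w\<in>carrier_vec m.
        e v \<otimes>\<^bsub>L\<^esub> h = h \<otimes>\<^bsub>L\<^esub> e w \<and> a \<bullet> w = b \<bullet> v)"
    if a: "a \<in> carrier_vec m" "a \<noteq> 0\<^sub>v m" for a
  proof -
    obtain i where i: "i < m" "a $ i \<noteq> 0"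
      using a by (metis carrier_vecD eq_vecI index_zero_vec)
    define T where "T = {b \<in> carrier_vec m. \<exists>t. t \<noteq> 0 \<and> b $ i = a $ i * t\<^sup>2}"
    have "\<exists>h\<in>carrier L. \<forall>v\<in>carrier_vec m. \<exists>w\<in>carrier_vec m.
        e v \<otimes>\<^bsub>L\<^esub> h = h \<otimes>\<^bsub>L\<^esub> e w \<and> a \<bullet> w = b \<bullet> v" if "b \<in> T" for b
    proof -
      obtain t where t: "b \<in> carrier_vec m" "t \<noteq> 0" "b $ i = a $ i * t\<^sup>2"
        using \<open>b \<in> T\<close> by (auto simp: T_def)
      obtain h where h: "h \<in> carrier (SL n)" and
        hw: "\<forall>v\<in>carrier_vec m. \<exists>w\<in>carrier_vec m.
          transvection_mat v * h = h * transvection_mat w \<and> a \<bullet> w = b \<bullet> v"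
        using transvection_orbit[OF a(1) i t(1,3,2)] unfolding n by blast
      show ?thesis
      proof (intro bexI[of _ "to_PSL n h"] ballI)
        fix v :: "'a vec" assume v: "v \<in> carrier_vec m"
        then obtain w where w: "w \<in> carrier_vec m"
          "transvection_mat v * h = h * transvection_mat w" "a \<bullet> w = b \<bullet> v"
          using hw by blast
        then show "\<exists>w\<in>carrier_vec m.
            e v \<otimes>\<^bsub>L\<^esub> to_PSL n h = to_PSL n h \<otimes>\<^bsub>L\<^esub> e w \<and> a \<bullet> w = b \<bullet> v"
          using v h by (intro bexI[of _ w]) (simp_all add: e_mult mult_e)
      qed (use h in \<open>simp add: \<open>L = PSL n\<close> to_PSL_closed\<close>)
    qed
    then show ?thesis
      using card_transvection_orbit[OF i] unfolding \<open>q = CARD('a)\<close>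
      by (intro exI[of _ T]) (auto simp: T_def)
  qed
  have q: "real q > 0"
    unfolding \<open>q = CARD('a)\<close> by simp
  have order: "real (card (carrier L)) > 0"
    using finite_carrier by (auto simp: card_gt_0_iff)
  have "(real q powr ((real n - 1) / 3)) ^ 3 = (real q powr ((real n - 1) / 3)) powr real 3"
    using q by (intro powr_realpow[symmetric]) simp
  also have "\<dots> = real q powr real m"
    unfolding powr_powr by (simp add: n)
  also have "\<dots> = real q ^ m"
    using q by (rule powr_realpow)
  finally have cube: "(real q powr ((real n - 1) / 3)) ^ 3 = real q ^ m" .
  have "(2 * real (card (carrier L)) / real q powr ((real n - 1) / 3)) ^ 3 \<le> real (card B) ^ 3"
    using assms(6) by (intro power_mono) (simp_all add: Coset.order_def)
  then have "8 * real (card (carrier L)) ^ 3 / real q ^ m \<le> real (card B) ^ 3"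
    by (simp add: power_divide power_mult_distrib cube)
  then have "8 * real (card (carrier L)) ^ 3 \<le> real q ^ m * real (card B) ^ 3"
    using q by (simp add: divide_le_eq mult.commute)
  moreover have "real (card (carrier L)) ^ 3 > 0"
    using order by simp
  \<comment> \<open>The orbit bound gives \<open>k = q ^ m / 4\<close>. The factor 2 in the size
    hypothesis becomes 8 on cubing, which beats this 4 and makes the inequality strict.\<close>
  ultimately have "real (card (carrier L)) ^ 3 < real q ^ m / 4 * real (card B) ^ 3"
    by linarith
  moreover have "e (unit_vec m 0) \<noteq> \<one>\<^bsub>L\<^esub>"
    using to_PSL_transvection_neq_one[of 0 m] m by (simp add: e_def n \<open>L = PSL n\<close>)
  ultimately show ?thesis
    using triple_product_eq_carrier[OF \<open>simple_group L\<close> \<open>B \<subseteq> carrier L\<close> _ _ orbit, of "unit_vec m 0"]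
    by simp
qed

end
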